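(* If $A$ is a geometrically closed ring, then every definable set of $A$ (with parameters in $A$) is positively definable; that is, $\mathrm{Def}_P(A)=\mathrm{Def}^+_P(A)$ for every finitely presented ring $P$.
   Context: All rings are commutative and unitary. A primitive morphism is a ring homomorphism $m:P\to Q$ between finitely presented rings (rings of the form $\mathbb{Z}[x_1,\ldots,x_n]/(p_1,\ldots,p_k)$). For a ring $A$ and a finitely presented ring $P$, $A_P=\hom(P,A)$; for $m:P\to Q$ primitive, $A_m:A_Q\to A_P$ is $c\mapsto cm$ and $\exists_m A=A_m(A_Q)$. An arithmetic axiom is a pair $\chi=[P,F]$ where $F$ is a finite (possibly empty) set of primitive morphisms with domain $P$; $A$ is a model of $\chi$ if $A_P=\bigcup_{m\in F}\exists_m A$. An arithmetic theory is a set of arithmetic axioms, and a model of it is a ring which is a model of all its axioms. $Th(A)$ is the set of all arithmetic axioms of which $A$ is a model. A ring homomorphism $f:B\to C$ is existentially closed if for every finite set $X$ of variables and every finitely generated ideal $I$ of $B[X]$ having a zero in $C^X$ through $f$, $I$ has a zero in $B^X$. An arithmetic theory is model complete if every ring homomorphism between models of it is existentially closed. A ring $A$ is geometrically closed if $Th(A)$ is model complete (equivalently, if $A$ is a model of some model complete arithmetic theory). For $P=\mathbb{Z}[x_1,\ldots,x_n]/(p_1,\ldots,p_k)$, identify $A_P$ with the zero set of $p_1,\ldots,p_k$ in $A^n$; an affine variety of $A_P$ is the set of elements of $A_P$ which are solutions of a finite system of polynomial equations in $x_1,\ldots,x_n$ with coefficients in $A$. The definable sets with parameters in $A$ form the smallest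 family $(\mathrm{Def}_P(A))_P$, indexed by the finitely presented rings $P$, such that: $\mathrm{Def}_P(A)$ is a Boolean subalgebra of the power set of $A_P$ containing the affine varieties of $A_P$, and for every primitive $m:P\to Q$ and every $X\in\mathrm{Def}_Q(A)$, $A_m(X)\in\mathrm{Def}_P(A)$. The positively definable sets form the smallest family $(\mathrm{Def}^+_P(A))_P$ obtained by omitting complements: $\mathrm{Def}^+_P(A)$ is a set of subsets of $A_P$ containing $\emptyset$, $A_P$ and the affine varieties of $A_P$, closed under finite unions and finite intersections, and for every primitive $m:P\to Q$ and $X\in\mathrm{Def}^+_Q(A)$, $A_m(X)\in\mathrm{Def}^+_P(A)$. *)

theory Defs
  imports "HOL-Algebra.IntRing" "HOL-Library.Multiset"
begin

section \<open>Polynomial rings in several variables\<close>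

text \<open>A polynomial over \<open>R\<close> in the variables \<open>X\<close> is its coefficient function on monomials; a monomial
  is a multiset of variables. HOL-Algebra has no ring of multivariate polynomials over a record-based
  ring (its theory \<open>Indexed_Polynomials\<close> provides no product), hence this construction.\<close>

definition MPoly :: "('a, 'r) ring_scheme \<Rightarrow> nat set \<Rightarrow> (nat multiset \<Rightarrow> 'a) ring"
  where "MPoly R X =
    \<lparr>carrier = {p. (\<forall>M. p M \<in> carrier R) \<and> finite {M. p M \<noteq> \<zero>\<^bsub>R\<^esub>} \<and>
                   (\<forall>M. p M \<noteq> \<zero>\<^bsub>R\<^esub> \<longrightarrow> set_mset M \<subseteq> X)},
     mult = (\<lambda>p q M. \<Oplus>\<^bsub>R\<^esub>N\<in>{N. N \<subseteq># M}. p N \<otimes>\<^bsub>R\<^esub> q (M - N)),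
     one = (\<lambda>M. if M = {#} then \<one>\<^bsub>R\<^esub> else \<zero>\<^bsub>R\<^esub>),
     zero = (\<lambda>M. \<zero>\<^bsub>R\<^esub>),
     add = (\<lambda>p q M. p M \<oplus>\<^bsub>R\<^esub> q M)\<rparr>"

definition Var :: "('a, 'r) ring_scheme \<Rightarrow> nat \<Rightarrow> nat multiset \<Rightarrow> 'a"
  where "Var R i = (\<lambda>M. if M = {#i#} then \<one>\<^bsub>R\<^esub> else \<zero>\<^bsub>R\<^esub>)"

definition mpoly_eval :: "('a, 'r) ring_scheme \<Rightarrow> (nat \<Rightarrow> 'a) \<Rightarrow> (nat multiset \<Rightarrow> 'a) \<Rightarrow> 'a"
  where "mpoly_eval R c p =
    (\<Oplus>\<^bsub>R\<^esub>M\<in>{M. p M \<noteq> \<zero>\<^bsub>R\<^esub>}. p M \<otimes>\<^bsub>R\<^esub> (\<Otimes>\<^bsub>R\<^esub>i\<in>set_mset M. c i [^]\<^bsub>R\<^esub> count M i))"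

section \<open>Finitely presented rings and primitive morphisms\<close>

text \<open>\<open>(n, [p\<^sub>1, \<dots>, p\<^sub>k])\<close> stands for \<open>\<int>[x\<^sub>1, \<dots>, x\<^sub>n] / (p\<^sub>1, \<dots>, p\<^sub>k)\<close>; the variables are numbered from 0.\<close>

type_synonym presentation = "nat \<times> (nat multiset \<Rightarrow> int) list"
type_synonym fp_elem = "(nat multiset \<Rightarrow> int) set"

definition presentation :: "presentation \<Rightarrow> bool"
  where "presentation P \<longleftrightarrow> set (snd P) \<subseteq> carrier (MPoly \<Z> {..<fst P})"

definition fp_ideal :: "presentation \<Rightarrow> (nat multiset \<Rightarrow> int) set"
  where "fp_ideal P = Idl\<^bsub>MPoly \<Z> {..<fst P}\<^esub> (set (snd P))"

definition fp_ring :: "presentation \<Rightarrow> fp_elem ring"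
  where "fp_ring P = MPoly \<Z> {..<fst P} Quot fp_ideal P"

definition fp_gen :: "presentation \<Rightarrow> nat \<Rightarrow> fp_elem"
  where "fp_gen P i = fp_ideal P +>\<^bsub>MPoly \<Z> {..<fst P}\<^esub> Var \<Z> i"

text \<open>Extensionality makes distinct functions distinct homomorphisms.\<close>

definition Hom :: "('a, 'r) ring_scheme \<Rightarrow> ('b, 's) ring_scheme \<Rightarrow> ('a \<Rightarrow> 'b) set"
  where "Hom R S = ring_hom R S \<inter> extensional (carrier R)"

definition points :: "('a, 'r) ring_scheme \<Rightarrow> presentation \<Rightarrow> (fp_elem \<Rightarrow> 'a) set"
  where "points A P = Hom (fp_ring P) A"

definition primitive :: "presentation \<Rightarrow> presentation \<Rightarrow> (fp_elem \<Rightarrow> fp_elem) \<Rightarrow> bool"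
  where "primitive P Q m \<longleftrightarrow> presentation P \<and> presentation Q \<and> m \<in> Hom (fp_ring P) (fp_ring Q)"

definition points_map :: "presentation \<Rightarrow> (fp_elem \<Rightarrow> fp_elem) \<Rightarrow> (fp_elem \<Rightarrow> 'a) \<Rightarrow> fp_elem \<Rightarrow> 'a"
  where "points_map P m c = compose (carrier (fp_ring P)) c m"

definition ex_image ::
    "('a, 'r) ring_scheme \<Rightarrow> presentation \<Rightarrow> presentation \<Rightarrow> (fp_elem \<Rightarrow> fp_elem) \<Rightarrow> (fp_elem \<Rightarrow> 'a) set"
  where "ex_image A P Q m = points_map P m ` points A Q"

section \<open>Arithmetic theories\<close>

text \<open>In \<open>(P, F)\<close> every element \<open>(Q, m)\<close> of \<open>F\<close> is a primitive morphism \<open>m\<close> together with its codomain.\<close>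

type_synonym arith_axiom = "presentation \<times> (presentation \<times> (fp_elem \<Rightarrow> fp_elem)) set"

definition arithmetic_axiom :: "arith_axiom \<Rightarrow> bool"
  where "arithmetic_axiom \<chi> \<longleftrightarrow> presentation (fst \<chi>) \<and> finite (snd \<chi>) \<and>
    (\<forall>(Q, m)\<in>snd \<chi>. primitive (fst \<chi>) Q m)"

definition model_of :: "('a, 'r) ring_scheme \<Rightarrow> arith_axiom \<Rightarrow> bool"
  where "model_of A \<chi> \<longleftrightarrow> points A (fst \<chi>) = (\<Union>(Q, m)\<in>snd \<chi>. ex_image A (fst \<chi>) Q m)"

definition Th :: "('a, 'r) ring_scheme \<Rightarrow> arith_axiom set"
  where "Th A = {\<chi>. arithmetic_axiom \<chi> \<and> model_of A \<chi>}"

definition theory_model :: "arith_axiom set \<Rightarrow> ('a, 'r) ring_scheme \<Rightarrow> bool"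
  where "theory_model T B \<longleftrightarrow> cring B \<and> (\<forall>\<chi>\<in>T. model_of B \<chi>)"

definition existentially_closed ::
    "('b, 'r) ring_scheme \<Rightarrow> ('c, 's) ring_scheme \<Rightarrow> ('b \<Rightarrow> 'c) \<Rightarrow> bool"
  where "existentially_closed B C f \<longleftrightarrow>
    (\<forall>X I. finite X \<longrightarrow>
      (\<exists>S. finite S \<and> S \<subseteq> carrier (MPoly B X) \<and> I = Idl\<^bsub>MPoly B X\<^esub> S) \<longrightarrow>
      (\<exists>c\<in>X \<rightarrow> carrier C. \<forall>p\<in>I. mpoly_eval C c (f \<circ> p) = \<zero>\<^bsub>C\<^esub>) \<longrightarrow>
      (\<exists>b\<in>X \<rightarrow> carrier B. \<forall>p\<in>I. mpoly_eval B b p = \<zero>\<^bsub>B\<^esub>))"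

text \<open>HOL cannot quantify over all types inside a formula, so the models range over the rings whose
  carrier is a subset of the type \<open>'u\<close>, which serves as universe. Only infinite universes are meaningful
  here; by Loewenheim--Skolem they all give the same notion, namely the one for models of arbitrary size.\<close>

definition model_complete :: "'u itself \<Rightarrow> arith_axiom set \<Rightarrow> bool"
  where "model_complete U T \<longleftrightarrow>
    (\<forall>(B :: 'u ring) (C :: 'u ring) f.
      theory_model T B \<longrightarrow> theory_model T C \<longrightarrow> f \<in> ring_hom B C \<longrightarrow> existentially_closed B C f)"

definition geometrically_closed :: "'u itself \<Rightarrow> ('a, 'r) ring_scheme \<Rightarrow> bool"
  where "geometrically_closed U A \<longleftrightarrow> cring A \<and> model_complete U (Th A)"

section \<open>Definable sets with parameters\<close>

text \<open>A point \<open>c\<close> of \<open>P\<close> is identified with the tuple of the values of \<open>c\<close> at the generators.\<close>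

definition affine_variety :: "('a, 'r) ring_scheme \<Rightarrow> presentation \<Rightarrow> (fp_elem \<Rightarrow> 'a) set \<Rightarrow> bool"
  where "affine_variety A P V \<longleftrightarrow>
    (\<exists>S. finite S \<and> S \<subseteq> carrier (MPoly A {..<fst P}) \<and>
      V = {c \<in> points A P. \<forall>p\<in>S. mpoly_eval A (\<lambda>i. c (fp_gen P i)) p = \<zero>\<^bsub>A\<^esub>})"

inductive definable :: "('a, 'r) ring_scheme \<Rightarrow> presentation \<Rightarrow> (fp_elem \<Rightarrow> 'a) set \<Rightarrow> bool"
  for A :: "('a, 'r) ring_scheme" where
  empty: "presentation P \<Longrightarrow> definable A P {}"
| top: "presentation P \<Longrightarrow> definable A P (points A P)"
| variety: "presentation P \<Longrightarrow> affine_variety A P V \<Longrightarrow> definable A P V"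
| union: "definable A P V \<Longrightarrow> definable A P W \<Longrightarrow> definable A P (V \<union> W)"
| inter: "definable A P V \<Longrightarrow> definable A P W \<Longrightarrow> definable A P (V \<inter> W)"
| compl: "definable A P V \<Longrightarrow> definable A P (points A P - V)"
| image: "primitive P Q m \<Longrightarrow> definable A Q V \<Longrightarrow> definable A P (points_map P m ` V)"

inductive pos_definable :: "('a, 'r) ring_scheme \<Rightarrow> presentation \<Rightarrow> (fp_elem \<Rightarrow> 'a) set \<Rightarrow> bool"
  for A :: "('a, 'r) ring_scheme" where
  empty: "presentation P \<Longrightarrow> pos_definable A P {}"
| top: "presentation P \<Longrightarrow> pos_definable A P (points A P)"
| variety: "presentation P \<Longrightarrow> affine_variety A P V \<Longrightarrow> pos_definable A P V"
| union: "pos_definable A P V \<Longrightarrow> pos_definable A P W \<Longrightarrow> pos_definable A P (V \<union> W)"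
| inter: "pos_definable A P V \<Longrightarrow> pos_definable A P W \<Longrightarrow> pos_definable A P (V \<inter> W)"
| image: "primitive P Q m \<Longrightarrow> pos_definable A Q V \<Longrightarrow> pos_definable A P (points_map P m ` V)"

definition Def_sets :: "('a, 'r) ring_scheme \<Rightarrow> presentation \<Rightarrow> (fp_elem \<Rightarrow> 'a) set set"
  where "Def_sets A P = {V. definable A P V}"

definition Def_pos_sets :: "('a, 'r) ring_scheme \<Rightarrow> presentation \<Rightarrow> (fp_elem \<Rightarrow> 'a) set set"
  where "Def_pos_sets A P = {V. pos_definable A P V}"

end

theory Submission
  imports Defs "HOL-Algebra.Weak_Morphisms" "HOL-Algebra.Subrings" "HOL-Library.Countable_Set"
begin

text \<open>Every primitive positive formula \<open>\<phi>\<close> has a positive existential complement over a geometrically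
  closed ring \<open>A\<close>: finitely many primitive positive formulas disjoint from \<open>\<phi>\<close> in \<open>A\<close> already cover
  its complement. Otherwise, since there are only countably many of them, some tuple \<open>b\<close> of an
  ultrapower of \<open>A\<close> violates \<open>\<phi>\<close> and all formulas disjoint from \<open>\<phi>\<close>. It lies in a countable model
  \<open>B\<close> of the theory of \<open>A\<close>. No formula true of \<open>b\<close> is disjoint from \<open>\<phi>\<close>, so every finite part of
  the positive diagram of \<open>B\<close> is realised in \<open>A\<close> together with \<open>\<phi>\<close>. This yields a homomorphism
  from \<open>B\<close> to another countable model in which \<open>\<phi>\<close> holds of the image of \<open>b\<close>, and model
  completeness forces \<open>\<phi>\<close> to hold of \<open>b\<close> in \<open>B\<close>, a contradiction. As all models involved are
  countable, they can be moved into any infinite universe. Parameters are treated as additional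
  free variables.\<close>

section \<open>Ring terms\<close>

text \<open>Formulas are lists of terms rather than of polynomials: for countably many variables the
  terms form a countable type, they allow renaming of variables, and the same term can be evaluated
  in every ring. In this language an axiom \<open>(P, F)\<close> says that finitely many equations
  imply a finite disjunction of primitive positive formulas, so Los's theorem for these formulas,
  plus the ultrafilter property for the disjunctions, carries the theory of \<open>A\<close> to an
  ultrapower. Homomorphisms need not be injective, which is why only equations, never inequations,
  of the diagram are realised.

  The obstacle is the universe \<open>'u\<close>: model completeness speaks only of rings over this
  type, whereas the ultrapower lives on \<open>(nat \<Rightarrow> 'a) set\<close> and may be too
  large. Hence \<open>B\<close> and \<open>C\<close> are copies of countable subrings of one and the
  same ultrapower, the one for \<open>C\<close> chosen to contain the image of \<open>B\<close>
  under the new homomorphism. The parameters from \<open>A\<close> may be uncountable, but a single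
  formula has only finitely many free variables, so these are renamed to numbers before countability
  is used.\<close>

datatype (vars: 'v) rterm =
    TVar 'v | TZero | TOne | TNeg "'v rterm" | TAdd "'v rterm" "'v rterm" | TMul "'v rterm" "'v rterm"

instance rterm :: (countable) countable
  by countable_datatype

primrec ev :: "('a, 'r) ring_scheme \<Rightarrow> ('v \<Rightarrow> 'a) \<Rightarrow> 'v rterm \<Rightarrow> 'a" where
  "ev R \<rho> (TVar v) = \<rho> v"
| "ev R \<rho> TZero = \<zero>\<^bsub>R\<^esub>"
| "ev R \<rho> TOne = \<one>\<^bsub>R\<^esub>"
| "ev R \<rho> (TNeg s) = \<ominus>\<^bsub>R\<^esub> ev R \<rho> s"
| "ev R \<rho> (TAdd s t) = ev R \<rho> s \<oplus>\<^bsub>R\<^esub> ev R \<rho> t"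
| "ev R \<rho> (TMul s t) = ev R \<rho> s \<otimes>\<^bsub>R\<^esub> ev R \<rho> t"

lemma finite_vars [simp]: "finite (vars t)"
  by (induction t) auto

lemma ev_cong: "(\<And>v. v \<in> vars t \<Longrightarrow> \<rho> v = \<sigma> v) \<Longrightarrow> ev R \<rho> t = ev R \<sigma> t"
  by (induction t) auto

lemma ev_map: "ev R \<rho> (map_rterm g t) = ev R (\<rho> \<circ> g) t"
  by (induction t) auto

lemma (in ring) ev_closed: "(\<And>v. v \<in> vars t \<Longrightarrow> \<rho> v \<in> carrier R) \<Longrightarrow> ev R \<rho> t \<in> carrier R"
  by (induction t) auto

lemma ev_hom:
  assumes "ring R" "ring S" "h \<in> ring_hom R S" "\<And>v. v \<in> vars t \<Longrightarrow> \<rho> v \<in> carrier R"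
  shows "h (ev R \<rho> t) = ev S (h \<circ> \<rho>) t"
proof -
  interpret h: ring_hom_ring R S h
    using assms(1-3) by (intro ring_hom_ringI2)
  show ?thesis
    using assms(4) by (induction t) (auto simp: h.R.ev_closed)
qed

section \<open>The polynomial ring\<close>

text \<open>Products in \<open>MPoly\<close> sum over this set, and a sum over an infinite index set
  would be 0 by convention.\<close>

lemma finite_submultisets: "finite {N. N \<subseteq># M}"
proof (induction M)
  case (add a M)
  have "{N. N \<subseteq># add_mset a M} \<subseteq> {N. N \<subseteq># M} \<union> add_mset a ` {N. N \<subseteq># M}"
  proof
    fix N assume N: "N \<in> {N. N \<subseteq># add_mset a M}"
    show "N \<in> {N. N \<subseteq># M} \<union> add_mset a ` {N. N \<subseteq># M}"
    proof (cases "a \<in># N")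
      case True
      then have "N - {#a#} \<subseteq># M" "N = add_mset a (N - {#a#})"
        using N by (auto simp: subset_eq_diff_conv)
      then show ?thesis by blast
    next
      case False
      have "count N x \<le> count M x" for x
        using N False mset_subset_eq_count[of N "add_mset a M" x]
        by (cases "x = a") (auto simp: not_in_iff)
      then have "N \<subseteq># M"
        by (rule mset_subset_eqI)
      then show ?thesis by blast
    qed
  qed
  then show ?case
    using add by (auto intro: finite_subset)
qed auto

lemma MPoly_simps [simp]:
  "mult (MPoly R X) p q = (\<lambda>M. \<Oplus>\<^bsub>R\<^esub>N\<in>{N. N \<subseteq># M}. p N \<otimes>\<^bsub>R\<^esub> q (M - N))"
  "one (MPoly R X) = (\<lambda>M. if M = {#} then \<one>\<^bsub>R\<^esub> else \<zero>\<^bsub>R\<^esub>)"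
  "zero (MPoly R X) = (\<lambda>M. \<zero>\<^bsub>R\<^esub>)"
  "add (MPoly R X) p q = (\<lambda>M. p M \<oplus>\<^bsub>R\<^esub> q M)"
  by (auto simp: MPoly_def)

lemma MPoly_carrier: "p \<in> carrier (MPoly R X) \<longleftrightarrow>
    (\<forall>M. p M \<in> carrier R) \<and> finite {M. p M \<noteq> \<zero>\<^bsub>R\<^esub>} \<and> (\<forall>M. p M \<noteq> \<zero>\<^bsub>R\<^esub> \<longrightarrow> set_mset M \<subseteq> X)"
  by (auto simp: MPoly_def)

definition monomial :: "('a, 'r) ring_scheme \<Rightarrow> 'a \<Rightarrow> nat multiset \<Rightarrow> nat multiset \<Rightarrow> 'a"
  where "monomial R a M = (\<lambda>N. if N = M then a else \<zero>\<^bsub>R\<^esub>)"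

lemma Var_monomial: "Var R i = monomial R \<one>\<^bsub>R\<^esub> {#i#}"
  by (simp add: Var_def monomial_def)

context cring
begin

lemma monomial_carrier [simp]:
  "a \<in> carrier R \<Longrightarrow> set_mset M \<subseteq> X \<Longrightarrow> monomial R a M \<in> carrier (MPoly R X)"
  by (auto simp: MPoly_carrier monomial_def)

lemma MPoly_add_closed [simp]:
  assumes "p \<in> carrier (MPoly R X)" "q \<in> carrier (MPoly R X)"
  shows "p \<oplus>\<^bsub>MPoly R X\<^esub> q \<in> carrier (MPoly R X)"
proof -
  have "{M. p M \<oplus> q M \<noteq> \<zero>} \<subseteq> {M. p M \<noteq> \<zero>} \<union> {M. q M \<noteq> \<zero>}" by auto
  then show ?thesis
    using assms by (auto simp: MPoly_carrier intro: finite_subset) (metis l_zero subset_iff zero_closed)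
qed

text \<open>Monomials are peeled off the finite support one at a time. Laws that are additive in
  each argument are thereby reduced to monomials, whose products are explicit.\<close>

lemma MPoly_induct [consumes 1, case_names monomial add]:
  assumes "p \<in> carrier (MPoly R X)"
    and mono: "\<And>a M. a \<in> carrier R \<Longrightarrow> set_mset M \<subseteq> X \<Longrightarrow> P (monomial R a M)"
    and add: "\<And>p q. p \<in> carrier (MPoly R X) \<Longrightarrow> q \<in> carrier (MPoly R X) \<Longrightarrow> P p \<Longrightarrow> P q \<Longrightarrow>
      P (p \<oplus>\<^bsub>MPoly R X\<^esub> q)"
  shows "P p"
proof -
  have "finite {M. p M \<noteq> \<zero>}"
    using assms(1) by (simp add: MPoly_carrier)
  then show ?thesis
    using assms(1)
  proof (induction "{M. p M \<noteq> \<zero>}" arbitrary: p rule: finite_induct)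
    case empty
    then have "p = monomial R \<zero> {#}"
      by (auto simp: monomial_def fun_eq_iff)
    then show ?case by (simp add: mono)
  next
    case (insert M F)
    let ?q = "p(M := \<zero>)"
    have F: "F = {N. ?q N \<noteq> \<zero>}"
      using insert.hyps by auto
    then have q: "?q \<in> carrier (MPoly R X)"
      using insert.prems insert.hyps(1) by (auto simp: MPoly_carrier)
    have M: "p M \<in> carrier R" "set_mset M \<subseteq> X"
      using insert.hyps(4) insert.prems by (auto simp: MPoly_carrier)
    have "p = monomial R (p M) M \<oplus>\<^bsub>MPoly R X\<^esub> ?q"
      using insert.prems by (auto simp: monomial_def fun_eq_iff MPoly_carrier)
    then show ?case
      using add[of "monomial R (p M) M" ?q] insert.hyps(3)[OF F q] mono[OF M] q M by auto
  qed
qed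

lemma MPoly_mult_closed [simp]:
  assumes p: "p \<in> carrier (MPoly R X)" and q: "q \<in> carrier (MPoly R X)"
  shows "p \<otimes>\<^bsub>MPoly R X\<^esub> q \<in> carrier (MPoly R X)"
proof -
  let ?A = "{M. p M \<noteq> \<zero>}" and ?B = "{M. q M \<noteq> \<zero>}"
  have carr: "p N \<in> carrier R" "q N \<in> carrier R" for N
    using p q by (auto simp: MPoly_carrier)
  \<comment> \<open>A nonzero coefficient needs a nonzero summand, so its monomial is a sum of one
    monomial from each support.\<close>
  have supp: "\<exists>N\<in>?A. \<exists>K\<in>?B. M = N + K" if "(\<Oplus>N\<in>{N. N \<subseteq># M}. p N \<otimes> q (M - N)) \<noteq> \<zero>" for M
  proof -
    from that obtain N where "N \<subseteq># M" "p N \<otimes> q (M - N) \<noteq> \<zero>"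
      using add.finprod_one_eqI[of "{N. N \<subseteq># M}" "\<lambda>N. p N \<otimes> q (M - N)"] by auto
    then show ?thesis
      using carr by (intro bexI[of _ N] bexI[of _ "M - N"]) auto
  qed
  have "{M. (\<Oplus>N\<in>{N. N \<subseteq># M}. p N \<otimes> q (M - N)) \<noteq> \<zero>} \<subseteq> (\<lambda>(N, K). N + K) ` (?A \<times> ?B)"
    using supp by fastforce
  moreover have "finite ((\<lambda>(N, K). N + K) ` (?A \<times> ?B))"
    using p q by (intro finite_imageI finite_cartesian_product) (auto simp: MPoly_carrier)
  moreover have "set_mset M \<subseteq> X" if "(\<Oplus>N\<in>{N. N \<subseteq># M}. p N \<otimes> q (M - N)) \<noteq> \<zero>" for M
    using supp[OF that] p q by (fastforce simp: MPoly_carrier)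
  ultimately show ?thesis
    using carr by (auto simp: MPoly_carrier intro: finite_subset)
qed

lemma MPoly_l_distr:
  assumes "p \<in> carrier (MPoly R X)" "q \<in> carrier (MPoly R X)" "r \<in> carrier (MPoly R X)"
  shows "(p \<oplus>\<^bsub>MPoly R X\<^esub> q) \<otimes>\<^bsub>MPoly R X\<^esub> r = p \<otimes>\<^bsub>MPoly R X\<^esub> r \<oplus>\<^bsub>MPoly R X\<^esub> q \<otimes>\<^bsub>MPoly R X\<^esub> r"
  using assms by (auto simp: MPoly_carrier fun_eq_iff l_distr Pi_iff simp flip: finsum_addf)

lemma MPoly_r_distr:
  assumes "p \<in> carrier (MPoly R X)" "q \<in> carrier (MPoly R X)" "r \<in> carrier (MPoly R X)"
  shows "r \<otimes>\<^bsub>MPoly R X\<^esub> (p \<oplus>\<^bsub>MPoly R X\<^esub> q) = r \<otimes>\<^bsub>MPoly R X\<^esub> p \<oplus>\<^bsub>MPoly R X\<^esub> r \<otimes>\<^bsub>MPoly R X\<^esub> q"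
  using assms by (auto simp: MPoly_carrier fun_eq_iff r_distr Pi_iff simp flip: finsum_addf)

text \<open>In the convolution sum at \<open>L\<close> only \<open>K = M\<close> can contribute, and
  then only if \<open>L - M = N\<close>.\<close>

lemma monomial_mult:
  assumes "a \<in> carrier R" "b \<in> carrier R"
  shows "monomial R a M \<otimes>\<^bsub>MPoly R X\<^esub> monomial R b N = monomial R (a \<otimes> b) (M + N)"
proof
  fix L
  show "(monomial R a M \<otimes>\<^bsub>MPoly R X\<^esub> monomial R b N) L = monomial R (a \<otimes> b) (M + N) L"
  proof (cases "L = M + N")
    case True
    have "(\<Oplus>K\<in>{K. K \<subseteq># L}. monomial R a M K \<otimes> monomial R b N (L - K)) =
        (\<Oplus>K\<in>{K. K \<subseteq># L}. if M = K then a \<otimes> b else \<zero>)"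
      using assms True by (intro finsum_cong) (auto simp: monomial_def simp_implies_def)
    also have "\<dots> = a \<otimes> b"
      using assms True by (subst finsum_singleton) (auto simp: finite_submultisets)
    finally show ?thesis
      by (simp add: True monomial_def)
  next
    case False
    have "(\<Oplus>K\<in>{K. K \<subseteq># L}. monomial R a M K \<otimes> monomial R b N (L - K)) = \<zero>"
      using assms False by (intro add.finprod_one_eqI) (auto simp: monomial_def)
    then show ?thesis
      using False by (simp add: monomial_def)
  qed
qed

lemma MPoly_comm:
  assumes p: "p \<in> carrier (MPoly R X)" and q: "q \<in> carrier (MPoly R X)"
  shows "p \<otimes>\<^bsub>MPoly R X\<^esub> q = q \<otimes>\<^bsub>MPoly R X\<^esub> p"
  using p
proof (induction p rule: MPoly_induct)
  case m: (monomial a M)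
  from q show ?case
  proof (induction q rule: MPoly_induct)
    case (monomial b N)
    then show ?case
      using m by (simp only: monomial_mult m_comm add.commute)
  next
    case (add p q)
    then show ?case
      using m by (simp only: MPoly_r_distr MPoly_l_distr monomial_carrier)
  qed
next
  case (add p1 p2)
  then show ?case
    using q by (simp only: MPoly_r_distr MPoly_l_distr)
qed

lemma MPoly_assoc:
  assumes p: "p \<in> carrier (MPoly R X)" and q: "q \<in> carrier (MPoly R X)" and r: "r \<in> carrier (MPoly R X)"
  shows "(p \<otimes>\<^bsub>MPoly R X\<^esub> q) \<otimes>\<^bsub>MPoly R X\<^esub> r = p \<otimes>\<^bsub>MPoly R X\<^esub> (q \<otimes>\<^bsub>MPoly R X\<^esub> r)"
  using p
proof (induction p rule: MPoly_induct)
  case m: (monomial a M)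
  from q show ?case
  proof (induction q rule: MPoly_induct)
    case m': (monomial b N)
    from r show ?case
    proof (induction r rule: MPoly_induct)
      case (monomial c L)
      then show ?case
        using m m' by (simp only: monomial_mult m_assoc add.assoc m_closed)
    next
      case (add p q)
      then show ?case
        using m m' by (simp only: MPoly_r_distr monomial_carrier MPoly_mult_closed)
    qed
  next
    case (add q1 q2)
    then show ?case
      using m r by (simp only: MPoly_r_distr MPoly_l_distr monomial_carrier MPoly_mult_closed)
  qed
next
  case (add p1 p2)
  then show ?case
    using q r by (simp only: MPoly_l_distr MPoly_mult_closed)
qed

lemma one_MPoly: "\<one>\<^bsub>MPoly R X\<^esub> = monomial R \<one> {#}"
  by (simp add: monomial_def)

lemma MPoly_l_one:
  assumes "p \<in> carrier (MPoly R X)"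
  shows "\<one>\<^bsub>MPoly R X\<^esub> \<otimes>\<^bsub>MPoly R X\<^esub> p = p"
  using assms unfolding one_MPoly
proof (induction p rule: MPoly_induct)
  case (monomial a M)
  then show ?case by (simp only: monomial_mult one_closed l_one add_0)
next
  case (add p q)
  then show ?case by (simp only: MPoly_r_distr monomial_carrier one_closed set_mset_empty empty_subsetI)
qed

lemma MPoly_cring: "cring (MPoly R X)"
proof (rule cringI)
  show "abelian_group (MPoly R X)"
  proof (rule abelian_groupI)
    show "p \<oplus>\<^bsub>MPoly R X\<^esub> q \<in> carrier (MPoly R X)"
      if "p \<in> carrier (MPoly R X)" "q \<in> carrier (MPoly R X)" for p q
      using that by (rule MPoly_add_closed)
  next
    fix p assume p: "p \<in> carrier (MPoly R X)"
    then have "{M. p M \<noteq> \<zero>} = {M. \<ominus> p M \<noteq> \<zero>}"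
      by (auto simp: MPoly_carrier)
    then show "\<exists>q\<in>carrier (MPoly R X). q \<oplus>\<^bsub>MPoly R X\<^esub> p = \<zero>\<^bsub>MPoly R X\<^esub>"
      using p by (intro bexI[of _ "\<lambda>M. \<ominus> p M"]) (auto simp: MPoly_carrier l_neg set_eq_iff)
  qed (auto simp: MPoly_carrier a_ac)
  show "comm_monoid (MPoly R X)"
  proof (rule comm_monoidI)
    show "\<one>\<^bsub>MPoly R X\<^esub> \<in> carrier (MPoly R X)"
      unfolding one_MPoly by simp
  qed (fact MPoly_mult_closed MPoly_assoc MPoly_l_one MPoly_comm)+
qed (rule MPoly_l_distr)

end

section \<open>Evaluation of polynomials along a homomorphism of coefficients\<close>

lemma mpoly_mono_power_add:
  assumes "cring S" "c \<in> X \<rightarrow> carrier S" "set_mset M \<subseteq> X" "set_mset N \<subseteq> X"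
  shows "(\<Otimes>\<^bsub>S\<^esub>i\<in>set_mset (M + N). c i [^]\<^bsub>S\<^esub> count (M + N) i) =
    (\<Otimes>\<^bsub>S\<^esub>i\<in>set_mset M. c i [^]\<^bsub>S\<^esub> count M i) \<otimes>\<^bsub>S\<^esub> (\<Otimes>\<^bsub>S\<^esub>i\<in>set_mset N. c i [^]\<^bsub>S\<^esub> count N i)"
proof -
  interpret S: cring S by fact
  let ?U = "set_mset (M + N)"
  have U: "i \<in> ?U \<Longrightarrow> c i \<in> carrier S" for i
    using assms by auto
  \<comment> \<open>Variables missing from \<open>L\<close> have exponent 0 and contribute the
    factor 1, so all three products can share one index set.\<close>
  have ext: "(\<Otimes>\<^bsub>S\<^esub>i\<in>set_mset L. c i [^]\<^bsub>S\<^esub> count L i) = (\<Otimes>\<^bsub>S\<^esub>i\<in>?U. c i [^]\<^bsub>S\<^esub> count L i)"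
    if "set_mset L \<subseteq> ?U" for L
    using that U by (intro S.finprod_mono_neutral_cong_left) (auto simp: not_in_iff Pi_iff)
  have "(\<Otimes>\<^bsub>S\<^esub>i\<in>?U. c i [^]\<^bsub>S\<^esub> count (M + N) i) =
      (\<Otimes>\<^bsub>S\<^esub>i\<in>?U. c i [^]\<^bsub>S\<^esub> count M i \<otimes>\<^bsub>S\<^esub> c i [^]\<^bsub>S\<^esub> count N i)"
    using U by (intro S.finprod_cong) (auto simp: S.nat_pow_mult simp_implies_def)
  also have "\<dots> = (\<Otimes>\<^bsub>S\<^esub>i\<in>?U. c i [^]\<^bsub>S\<^esub> count M i) \<otimes>\<^bsub>S\<^esub> (\<Otimes>\<^bsub>S\<^esub>i\<in>?U. c i [^]\<^bsub>S\<^esub> count N i)"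
    using U by (intro S.finprod_multf) auto
  finally show ?thesis
    using ext[of M] ext[of N] by simp
qed

text \<open>Moving the coefficients by \<open>h\<close> first covers three cases at once: integer
  polynomials at points of any ring, polynomials over \<open>B\<close> at points of
  \<open>C\<close>, and ordinary evaluation with \<open>h = id\<close>.\<close>

locale poly_eval = R: cring R + S: cring S
  for R :: "('a, 'r) ring_scheme" and S :: "('b, 's) ring_scheme" +
  fixes h :: "'a \<Rightarrow> 'b" and c :: "nat \<Rightarrow> 'b" and X :: "nat set"
  assumes h: "h \<in> ring_hom R S" and c: "c \<in> X \<rightarrow> carrier S"
begin

definition mono :: "nat multiset \<Rightarrow> 'b"
  where "mono M = (\<Otimes>\<^bsub>S\<^esub>i\<in>set_mset M. c i [^]\<^bsub>S\<^esub> count M i)"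

definition eval :: "(nat multiset \<Rightarrow> 'a) \<Rightarrow> 'b"
  where "eval p = mpoly_eval S c (h \<circ> p)"

lemma mono_closed [simp]: "set_mset M \<subseteq> X \<Longrightarrow> mono M \<in> carrier S"
  using c by (auto simp: mono_def intro!: S.finprod_closed)

lemma h_zero [simp]: "h \<zero>\<^bsub>R\<^esub> = \<zero>\<^bsub>S\<^esub>"
  using h R.ring_axioms S.ring_axioms by (rule ring_hom_zero)

lemma h_closed [simp]: "a \<in> carrier R \<Longrightarrow> h a \<in> carrier S"
  using h by (rule ring_hom_closed)

lemma summand_closed:
  "p \<in> carrier (MPoly R X) \<Longrightarrow> h (p M) \<otimes>\<^bsub>S\<^esub> (if set_mset M \<subseteq> X then mono M else \<zero>\<^bsub>S\<^esub>) \<in> carrier S"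
  by (auto simp: MPoly_carrier)

text \<open>The case distinction keeps the summands in the carrier when \<open>F\<close> contains monomials in
  variables outside \<open>X\<close>, at which \<open>c\<close> is arbitrary.\<close>

lemma eval_superset:
  assumes p: "p \<in> carrier (MPoly R X)" and F: "finite F" "{M. p M \<noteq> \<zero>\<^bsub>R\<^esub>} \<subseteq> F"
  shows "eval p = (\<Oplus>\<^bsub>S\<^esub>M\<in>F. h (p M) \<otimes>\<^bsub>S\<^esub> (if set_mset M \<subseteq> X then mono M else \<zero>\<^bsub>S\<^esub>))"
  unfolding eval_def mpoly_eval_def
proof (rule S.add.finprod_mono_neutral_cong_left)
  show "{M. (h \<circ> p) M \<noteq> \<zero>\<^bsub>S\<^esub>} \<subseteq> F"
    using F(2) by (force simp: subset_iff)
  fix M assume M: "M \<in> {M. (h \<circ> p) M \<noteq> \<zero>\<^bsub>S\<^esub>}"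
  then have "p M \<noteq> \<zero>\<^bsub>R\<^esub>" by auto
  then have "set_mset M \<subseteq> X"
    using p by (simp add: MPoly_carrier)
  then show "(h \<circ> p) M \<otimes>\<^bsub>S\<^esub> (\<Otimes>\<^bsub>S\<^esub>i\<in>set_mset M. c i [^]\<^bsub>S\<^esub> count M i) =
      h (p M) \<otimes>\<^bsub>S\<^esub> (if set_mset M \<subseteq> X then mono M else \<zero>\<^bsub>S\<^esub>)"
    by (simp add: mono_def)
qed (use p F in \<open>auto simp: MPoly_carrier\<close>)

lemma eval_closed: "p \<in> carrier (MPoly R X) \<Longrightarrow> eval p \<in> carrier S"
  using eval_superset[of p "{M. p M \<noteq> \<zero>\<^bsub>R\<^esub>}"] summand_closed[of p]
  by (auto simp: MPoly_carrier)

lemma eval_add: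
  assumes p: "p \<in> carrier (MPoly R X)" and q: "q \<in> carrier (MPoly R X)"
  shows "eval (p \<oplus>\<^bsub>MPoly R X\<^esub> q) = eval p \<oplus>\<^bsub>S\<^esub> eval q"
proof -
  let ?F = "{M. p M \<noteq> \<zero>\<^bsub>R\<^esub>} \<union> {M. q M \<noteq> \<zero>\<^bsub>R\<^esub>}"
  have F: "finite ?F" and carr: "p M \<in> carrier R" "q M \<in> carrier R" for M
    using p q by (auto simp: MPoly_carrier)
  have "{M. (p \<oplus>\<^bsub>MPoly R X\<^esub> q) M \<noteq> \<zero>\<^bsub>R\<^esub>} \<subseteq> ?F" by auto
  then have "eval (p \<oplus>\<^bsub>MPoly R X\<^esub> q) =
      (\<Oplus>\<^bsub>S\<^esub>M\<in>?F. h ((p \<oplus>\<^bsub>MPoly R X\<^esub> q) M) \<otimes>\<^bsub>S\<^esub> (if set_mset M \<subseteq> X then mono M else \<zero>\<^bsub>S\<^esub>))"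
    using F by (intro eval_superset R.MPoly_add_closed p q)
  also have "\<dots> = (\<Oplus>\<^bsub>S\<^esub>M\<in>?F. h (p M) \<otimes>\<^bsub>S\<^esub> (if set_mset M \<subseteq> X then mono M else \<zero>\<^bsub>S\<^esub>) \<oplus>\<^bsub>S\<^esub>
      h (q M) \<otimes>\<^bsub>S\<^esub> (if set_mset M \<subseteq> X then mono M else \<zero>\<^bsub>S\<^esub>))"
    using carr by (intro S.finsum_cong) (auto simp: simp_implies_def ring_hom_add[OF h] S.l_distr)
  also have "\<dots> = eval p \<oplus>\<^bsub>S\<^esub> eval q"
    using F carr eval_superset[OF p F] eval_superset[OF q F] summand_closed[OF p] summand_closed[OF q]
    by (subst S.finsum_addf) auto
  finally show ?thesis .
qed

lemma eval_monomial:
  assumes "a \<in> carrier R" "set_mset M \<subseteq> X"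
  shows "eval (monomial R a M) = h a \<otimes>\<^bsub>S\<^esub> mono M"
  using assms R.monomial_carrier[OF assms]
  by (subst eval_superset[where F = "{M}"]) (auto simp: monomial_def)

lemma eval_mult:
  assumes p: "p \<in> carrier (MPoly R X)" and q: "q \<in> carrier (MPoly R X)"
  shows "eval (p \<otimes>\<^bsub>MPoly R X\<^esub> q) = eval p \<otimes>\<^bsub>S\<^esub> eval q"
  using p
proof (induction p rule: R.MPoly_induct)
  case m: (monomial a M)
  from q show ?case
  proof (induction q rule: R.MPoly_induct)
    case (monomial b N)
    have "mono (M + N) = mono M \<otimes>\<^bsub>S\<^esub> mono N"
      using mpoly_mono_power_add[OF S.cring_axioms c] m monomial by (simp add: mono_def)
    moreover have "eval (monomial R a M \<otimes>\<^bsub>MPoly R X\<^esub> monomial R b N) = h (a \<otimes>\<^bsub>R\<^esub> b) \<otimes>\<^bsub>S\<^esub> mono (M + N)"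
      using m monomial by (subst R.monomial_mult) (auto intro!: eval_monomial)
    ultimately show ?case
      using m monomial by (simp add: eval_monomial ring_hom_mult[OF h] S.m_ac)
  next
    case (add p q)
    then show ?case
      using m by (simp only: R.MPoly_r_distr R.MPoly_mult_closed R.monomial_carrier eval_add eval_closed S.r_distr)
  qed
next
  case (add p1 p2)
  then show ?case
    using q by (simp only: R.MPoly_l_distr R.MPoly_mult_closed eval_add eval_closed S.l_distr)
qed

lemma mono_empty: "mono {#} = \<one>\<^bsub>S\<^esub>"
  by (simp add: mono_def)

lemma eval_const: "a \<in> carrier R \<Longrightarrow> eval (monomial R a {#}) = h a"
  by (simp add: eval_monomial mono_empty)

lemma eval_Var: "i \<in> X \<Longrightarrow> eval (Var R i) = c i"
  using c by (auto simp: Var_monomial eval_monomial mono_def ring_hom_one[OF h] Pi_iff)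

lemma eval_hom: "eval \<in> ring_hom (MPoly R X) S"
proof (rule ring_hom_memI)
  show "eval \<one>\<^bsub>MPoly R X\<^esub> = \<one>\<^bsub>S\<^esub>"
    unfolding R.one_MPoly by (simp add: eval_const ring_hom_one[OF h])
qed (fact eval_closed eval_add eval_mult)+

end

text \<open>The passage from polynomials to terms. How constants are named is left open: integers
  are built from 0 and 1, while elements of a general ring need variables of their own.\<close>

lemma MPoly_term_generated:
  fixes \<rho> :: "'v \<Rightarrow> nat multiset \<Rightarrow> 'a"
  assumes R: "cring R" and p: "p \<in> carrier (MPoly R X)"
    and const: "\<And>a. a \<in> carrier R \<Longrightarrow> \<exists>t. vars t \<subseteq> V \<and> ev (MPoly R X) \<rho> t = monomial R a {#}"
    and var: "\<And>i. i \<in> X \<Longrightarrow> \<exists>t. vars t \<subseteq> V \<and> ev (MPoly R X) \<rho> t = Var R i"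
  shows "\<exists>t. vars t \<subseteq> V \<and> ev (MPoly R X) \<rho> t = p"
proof -
  interpret R: cring R by fact
  define G where "G = {p. \<exists>t. vars t \<subseteq> V \<and> ev (MPoly R X) \<rho> t = p}"
  have add: "p \<oplus>\<^bsub>MPoly R X\<^esub> q \<in> G" if "p \<in> G" "q \<in> G" for p q
  proof -
    from that obtain s t where "vars s \<subseteq> V" "ev (MPoly R X) \<rho> s = p" "vars t \<subseteq> V" "ev (MPoly R X) \<rho> t = q"
      by (auto simp: G_def)
    then show ?thesis
      unfolding G_def by (intro CollectI exI[of _ "TAdd s t"]) auto
  qed
  have mult: "p \<otimes>\<^bsub>MPoly R X\<^esub> q \<in> G" if "p \<in> G" "q \<in> G" for p q
  proof -
    from that obtain s t where "vars s \<subseteq> V" "ev (MPoly R X) \<rho> s = p" "vars t \<subseteq> V" "ev (MPoly R X) \<rho> t = q"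
      by (auto simp: G_def)
    then show ?thesis
      unfolding G_def by (intro CollectI exI[of _ "TMul s t"]) auto
  qed
  have "p \<in> G"
    using p
  proof (induction p rule: R.MPoly_induct)
    case (monomial a M)
    from monomial(2) show ?case
    proof (induction M)
      case empty
      then show ?case using const monomial(1) by (simp add: G_def)
    next
      case (add i M)
      have "monomial R \<one>\<^bsub>R\<^esub> {#i#} \<in> G"
        using var add.prems by (auto simp: G_def Var_monomial)
      then have "monomial R \<one>\<^bsub>R\<^esub> {#i#} \<otimes>\<^bsub>MPoly R X\<^esub> monomial R a M \<in> G"
        using add by (intro mult) auto
      then show ?case
        using monomial(1) by (subst (asm) R.monomial_mult) auto
    qed
  qed (rule add)
  then show ?thesis by (simp add: G_def)
qed

section \<open>Points of finitely presented rings as zeros of integer polynomials\<close>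

lemma int_add_pow_hom:
  assumes "cring R"
  shows "(\<lambda>k::int. [k] \<cdot>\<^bsub>R\<^esub> \<one>\<^bsub>R\<^esub>) \<in> ring_hom \<Z> R"
proof -
  interpret R: cring R by fact
  show ?thesis
  proof (rule ring_hom_memI)
    fix k l :: int
    have "([k] \<cdot>\<^bsub>R\<^esub> \<one>\<^bsub>R\<^esub>) \<otimes>\<^bsub>R\<^esub> ([l] \<cdot>\<^bsub>R\<^esub> \<one>\<^bsub>R\<^esub>) = [k] \<cdot>\<^bsub>R\<^esub> ([l] \<cdot>\<^bsub>R\<^esub> \<one>\<^bsub>R\<^esub>)"
      by (subst R.add_pow_ldistr_int) auto
    then show "[(k \<otimes>\<^bsub>\<Z>\<^esub> l)] \<cdot>\<^bsub>R\<^esub> \<one>\<^bsub>R\<^esub> = ([k] \<cdot>\<^bsub>R\<^esub> \<one>\<^bsub>R\<^esub>) \<otimes>\<^bsub>R\<^esub> ([l] \<cdot>\<^bsub>R\<^esub> \<one>\<^bsub>R\<^esub>)"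
      by (simp add: R.add.int_pow_pow mult.commute)
  qed (auto simp: R.add.int_pow_mult)
qed

definition zeval :: "('a, 'r) ring_scheme \<Rightarrow> (nat \<Rightarrow> 'a) \<Rightarrow> (nat multiset \<Rightarrow> int) \<Rightarrow> 'a"
  where "zeval R x p = mpoly_eval R x ((\<lambda>k. [k] \<cdot>\<^bsub>R\<^esub> \<one>\<^bsub>R\<^esub>) \<circ> p)"

lemma zeval_poly_eval:
  assumes "cring R" "x \<in> X \<rightarrow> carrier R"
  shows "poly_eval \<Z> R (\<lambda>k. [k] \<cdot>\<^bsub>R\<^esub> \<one>\<^bsub>R\<^esub>) x X"
  using assms by (intro poly_eval.intro poly_eval_axioms.intro int_is_cring int_add_pow_hom)

lemma zeval_hom:
  assumes "cring R" "x \<in> X \<rightarrow> carrier R"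
  shows "zeval R x \<in> ring_hom (MPoly \<Z> X) R"
proof -
  have "poly_eval.eval R (\<lambda>k. [k] \<cdot>\<^bsub>R\<^esub> \<one>\<^bsub>R\<^esub>) x = zeval R x"
    by (rule ext) (simp add: poly_eval.eval_def[OF zeval_poly_eval[OF assms]] zeval_def)
  then show ?thesis
    using poly_eval.eval_hom[OF zeval_poly_eval[OF assms]] by metis
qed

lemma zeval_Var:
  assumes "cring R" "x \<in> X \<rightarrow> carrier R" "i \<in> X"
  shows "zeval R x (Var \<Z> i) = x i"
  using poly_eval.eval_Var[OF zeval_poly_eval[OF assms(1,2)] assms(3)]
  by (simp add: poly_eval.eval_def[OF zeval_poly_eval[OF assms(1,2)]] zeval_def)

lemmas MPoly_int_cring = cring.MPoly_cring[OF int_is_cring]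

lemma Var_int_carrier: "i \<in> X \<Longrightarrow> Var \<Z> i \<in> carrier (MPoly \<Z> X)"
  unfolding Var_monomial by (rule cring.monomial_carrier[OF int_is_cring]) auto

text \<open>Integer coefficients need no names, since every integer is reached from 0 by adding 1 or
  -1 repeatedly.\<close>

lemma MPoly_int_term:
  assumes "p \<in> carrier (MPoly \<Z> X)"
  shows "\<exists>t. vars t \<subseteq> X \<and> ev (MPoly \<Z> X) (Var \<Z>) t = p"
proof (rule MPoly_term_generated[OF int_is_cring assms])
  interpret M: cring "MPoly \<Z> X" by (rule MPoly_int_cring)
  \<comment> \<open>Negation in \<open>MPoly\<close> is only known as an additive inverse, so the
    constant -1 has to be identified by uniqueness of inverses.\<close>
  have neg: "ev (MPoly \<Z> X) (Var \<Z>) (TNeg TOne) = monomial \<Z> (- 1) {#}"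
  proof -
    have "\<ominus>\<^bsub>MPoly \<Z> X\<^esub> \<one>\<^bsub>MPoly \<Z> X\<^esub> = monomial \<Z> (- 1) {#}"
    proof (rule M.minus_equality)
      show "monomial \<Z> (- 1) {#} \<oplus>\<^bsub>MPoly \<Z> X\<^esub> \<one>\<^bsub>MPoly \<Z> X\<^esub> = \<zero>\<^bsub>MPoly \<Z> X\<^esub>"
        by (auto simp: monomial_def)
    qed (rule M.one_closed, rule cring.monomial_carrier[OF int_is_cring], auto)
    then show ?thesis by simp
  qed
  show "\<exists>t. vars t \<subseteq> X \<and> ev (MPoly \<Z> X) (Var \<Z>) t = monomial \<Z> a {#}" for a
  proof (induction a rule: int_induct[where k = 0])
    case base
    show ?case by (rule exI[of _ TZero]) (auto simp: monomial_def)
  next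
    case (step1 k)
    then obtain t where "vars t \<subseteq> X" "ev (MPoly \<Z> X) (Var \<Z>) t = monomial \<Z> k {#}" by blast
    then show ?case by (intro exI[of _ "TAdd t TOne"]) (auto simp: monomial_def)
  next
    case (step2 k)
    then obtain t where "vars t \<subseteq> X" "ev (MPoly \<Z> X) (Var \<Z>) t = monomial \<Z> k {#}" by blast
    then show ?case
      using neg by (intro exI[of _ "TAdd t (TNeg TOne)"]) (auto simp: monomial_def simp del: ev.simps(2-4))
  qed
  show "\<exists>t. vars t \<subseteq> X \<and> ev (MPoly \<Z> X) (Var \<Z>) t = Var \<Z> i" if "i \<in> X" for i
    using that by (intro exI[of _ "TVar i"]) auto
qed

text \<open>The choice depends on the polynomial alone, so the same term serves over every
  ring.\<close>

definition zterm :: "nat set \<Rightarrow> (nat multiset \<Rightarrow> int) \<Rightarrow> nat rterm"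
  where "zterm X p = (SOME t. vars t \<subseteq> X \<and> ev (MPoly \<Z> X) (Var \<Z>) t = p)"

lemma zterm:
  assumes "p \<in> carrier (MPoly \<Z> X)"
  shows "vars (zterm X p) \<subseteq> X" "ev (MPoly \<Z> X) (Var \<Z>) (zterm X p) = p"
  using someI_ex[OF MPoly_int_term[OF assms]] by (auto simp: zterm_def)

text \<open>Homomorphisms commute with terms, hence are determined by their values at the
  variables.\<close>

lemma hom_MPoly_int:
  assumes R: "cring R" and g: "g \<in> ring_hom (MPoly \<Z> X) R" and p: "p \<in> carrier (MPoly \<Z> X)"
  shows "g p = ev R (\<lambda>i. g (Var \<Z> i)) (zterm X p)"
proof -
  have "g (ev (MPoly \<Z> X) (Var \<Z>) (zterm X p)) = ev R (g \<circ> Var \<Z>) (zterm X p)"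
    using zterm(1)[OF p] R MPoly_int_cring
    by (intro ev_hom g) (auto simp: cring_def Var_int_carrier)
  then show ?thesis
    by (simp add: zterm(2)[OF p] o_def)
qed

lemma ev_zterm:
  assumes R: "cring R" and p: "p \<in> carrier (MPoly \<Z> X)" and x: "x \<in> X \<rightarrow> carrier R"
  shows "ev R x (zterm X p) = zeval R x p"
proof -
  have "zeval R x p = ev R (\<lambda>i. zeval R x (Var \<Z> i)) (zterm X p)"
    using hom_MPoly_int[OF R zeval_hom[OF R x] p] .
  also have "\<dots> = ev R x (zterm X p)"
    using zterm(1)[OF p] by (intro ev_cong) (auto simp: zeval_Var[OF R x])
  finally show ?thesis by simp
qed

lemma hom_MPoly_int_zeval:
  assumes R: "cring R" and g: "g \<in> ring_hom (MPoly \<Z> X) R" and p: "p \<in> carrier (MPoly \<Z> X)"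
  shows "g p = zeval R (\<lambda>i. g (Var \<Z> i)) p"
  using hom_MPoly_int[OF assms] ev_zterm[OF R p, of "\<lambda>i. g (Var \<Z> i)"] ring_hom_closed[OF g]
  by (auto simp: Var_int_carrier)

lemma zeval_cong:
  assumes R: "cring R" and p: "p \<in> carrier (MPoly \<Z> X)" and x: "x \<in> X \<rightarrow> carrier R"
    and eq: "\<And>i. i \<in> X \<Longrightarrow> x i = y i"
  shows "zeval R x p = zeval R y p"
proof -
  have "ev R x (zterm X p) = ev R y (zterm X p)"
    using zterm(1)[OF p] eq by (intro ev_cong) auto
  moreover have "y \<in> X \<rightarrow> carrier R"
    using x eq by (auto simp: Pi_iff)
  ultimately show ?thesis
    using ev_zterm[OF R p] x by simp
qed

section \<open>Finitely presented rings and the coordinates of their points\<close>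

lemma presentation_mem:
  "presentation P \<Longrightarrow> p \<in> set (snd P) \<Longrightarrow> p \<in> carrier (MPoly \<Z> {..<fst P})"
  by (auto simp: presentation_def)

lemma fp_ideal:
  assumes "presentation P"
  shows "ideal (fp_ideal P) (MPoly \<Z> {..<fst P})"
  using assms cring.axioms(1)[OF MPoly_int_cring]
  by (auto simp: fp_ideal_def presentation_def intro!: ring.genideal_ideal)

lemma fp_ring_cring: "presentation P \<Longrightarrow> cring (fp_ring P)"
  unfolding fp_ring_def by (intro ideal.quotient_is_cring fp_ideal MPoly_int_cring)

abbreviation fp_class :: "presentation \<Rightarrow> (nat multiset \<Rightarrow> int) \<Rightarrow> fp_elem"
  where "fp_class P p \<equiv> fp_ideal P +>\<^bsub>MPoly \<Z> {..<fst P}\<^esub> p"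

lemma fp_class_hom: "presentation P \<Longrightarrow> fp_class P \<in> ring_hom (MPoly \<Z> {..<fst P}) (fp_ring P)"
  unfolding fp_ring_def by (intro ideal.rcos_ring_hom fp_ideal)

lemma fp_ring_carrier: "carrier (fp_ring P) = fp_class P ` carrier (MPoly \<Z> {..<fst P})"
  by (auto simp: fp_ring_def FactRing_def A_RCOSETS_def')

lemma fp_class_zero:
  assumes "presentation P" "p \<in> set (snd P)"
  shows "fp_class P p = \<zero>\<^bsub>fp_ring P\<^esub>"
proof -
  interpret ideal "fp_ideal P" "MPoly \<Z> {..<fst P}"
    using assms(1) by (rule fp_ideal)
  have "p \<in> fp_ideal P"
    using assms genideal_self[of "set (snd P)"] by (auto simp: fp_ideal_def presentation_def)
  then show ?thesis
    by (simp add: a_rcos_const fp_ring_def FactRing_def)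
qed

lemma points_hom: "c \<in> points R P \<Longrightarrow> c \<in> ring_hom (fp_ring P) R"
  by (simp add: points_def Hom_def)

lemma point_fp_class:
  assumes R: "cring R" and P: "presentation P" and c: "c \<in> points R P"
    and p: "p \<in> carrier (MPoly \<Z> {..<fst P})"
  shows "c (fp_class P p) = zeval R (\<lambda>i. c (fp_gen P i)) p"
  using hom_MPoly_int_zeval[OF R ring_hom_trans[OF fp_class_hom[OF P] points_hom[OF c]] p]
  by (simp add: fp_gen_def)

text \<open>Only the coordinates below \<open>fst P\<close> are constrained, so many tuples describe
  the same point and tuples are compared only below this bound.\<close>

definition zeros :: "('a, 'r) ring_scheme \<Rightarrow> presentation \<Rightarrow> (nat \<Rightarrow> 'a) set"
  where "zeros R P = {x \<in> {..<fst P} \<rightarrow> carrier R. \<forall>p\<in>set (snd P). zeval R x p = \<zero>\<^bsub>R\<^esub>}"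

lemma fp_gen_carrier: "presentation P \<Longrightarrow> i < fst P \<Longrightarrow> fp_gen P i \<in> carrier (fp_ring P)"
  by (auto simp: fp_gen_def fp_ring_carrier Var_int_carrier)

lemma point_gen_carrier:
  "presentation P \<Longrightarrow> c \<in> points R P \<Longrightarrow> i < fst P \<Longrightarrow> c (fp_gen P i) \<in> carrier R"
  using ring_hom_closed[OF points_hom] fp_gen_carrier by blast

lemma point_zeros:
  assumes R: "cring R" and P: "presentation P" and c: "c \<in> points R P"
  shows "(\<lambda>i. c (fp_gen P i)) \<in> zeros R P"
proof -
  have "c \<zero>\<^bsub>fp_ring P\<^esub> = \<zero>\<^bsub>R\<^esub>"
    using R fp_ring_cring[OF P] by (intro ring_hom_zero points_hom[OF c]) (auto simp: cring_def)
  then show ?thesis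
    using point_fp_class[OF R P c, symmetric] point_gen_carrier[OF P c] presentation_mem[OF P]
    by (auto simp: zeros_def fp_class_zero[OF P])
qed

lemma point_unique:
  assumes R: "cring R" and P: "presentation P" and c: "c \<in> points R P" and d: "d \<in> points R P"
    and eq: "\<And>i. i < fst P \<Longrightarrow> c (fp_gen P i) = d (fp_gen P i)"
  shows "c = d"
proof (rule extensionalityI)
  show "c \<in> extensional (carrier (fp_ring P))" "d \<in> extensional (carrier (fp_ring P))"
    using c d by (auto simp: points_def Hom_def)
  fix a assume "a \<in> carrier (fp_ring P)"
  then obtain p where p: "p \<in> carrier (MPoly \<Z> {..<fst P})" "a = fp_class P p"
    by (auto simp: fp_ring_carrier)
  have "zeval R (\<lambda>i. c (fp_gen P i)) p = zeval R (\<lambda>i. d (fp_gen P i)) p"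
    using point_gen_carrier[OF P c] eq by (intro zeval_cong[OF R p(1)]) auto
  then show "c a = d a"
    by (simp only: p(2) point_fp_class[OF R P c p(1)] point_fp_class[OF R P d p(1)])
qed

text \<open>Evaluation at \<open>x\<close> kills the relators, hence the ideal they generate, and so
  factors through the quotient.\<close>

lemma point_exists:
  assumes R: "cring R" and P: "presentation P" and x: "x \<in> zeros R P"
  shows "\<exists>c\<in>points R P. \<forall>i<fst P. c (fp_gen P i) = x i"
proof -
  let ?M = "MPoly \<Z> {..<fst P}"
  interpret R: cring R by fact
  interpret M: cring ?M by (rule MPoly_int_cring)
  interpret I: ideal "fp_ideal P" ?M using P by (rule fp_ideal)
  have xc: "x \<in> {..<fst P} \<rightarrow> carrier R"
    using x by (simp add: zeros_def)
  interpret z: ring_hom_ring ?M R "zeval R x"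
    by (intro ring_hom_ringI2 M.ring_axioms R.ring_axioms zeval_hom R xc)
  have "fp_ideal P \<subseteq> a_kernel ?M R (zeval R x)"
    unfolding fp_ideal_def
  proof (rule M.genideal_minimal)
    show "ideal (a_kernel ?M R (zeval R x)) ?M"
      by (rule z.kernel_is_ideal)
    show "set (snd P) \<subseteq> a_kernel ?M R (zeval R x)"
      using x presentation_mem[OF P] unfolding zeros_def a_kernel_def' by blast
  qed
  then have ker: "zeval R x p = \<zero>\<^bsub>R\<^esub>" if "p \<in> fp_ideal P" for p
    using that unfolding a_kernel_def' by blast
  \<comment> \<open>Any representative will do, as two of them differ by an element of the ideal,
    which evaluation at \<open>x\<close> sends to 0. The restriction supplies the extensionality
    demanded by \<open>Hom\<close>.\<close>
  define c where "c = restrict (\<lambda>K. zeval R x (SOME p. p \<in> K)) (carrier (fp_ring P))"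
  have c: "c (fp_class P p) = zeval R x p" if p: "p \<in> carrier ?M" for p
  proof -
    have "p \<in> fp_class P p"
      using p by (rule I.a_rcos_self)
    then have "(SOME q. q \<in> fp_class P p) \<in> fp_class P p"
      by (rule someI[of "\<lambda>q. q \<in> fp_class P p"])
    then obtain i where "i \<in> fp_ideal P" "(SOME q. q \<in> fp_class P p) = i \<oplus>\<^bsub>?M\<^esub> p"
      by (auto simp: a_r_coset_def' simp del: MPoly_simps)
    then show ?thesis
      using p ker z.hom_add[of i p] I.Icarr by (auto simp: c_def fp_ring_carrier simp del: MPoly_simps)
  qed
  have "c \<in> ring_hom (fp_ring P) R"
  proof (rule ring_hom_memI)
    note hom = ring_hom_memE[OF fp_class_hom[OF P]]
    fix a assume "a \<in> carrier (fp_ring P)"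
    then obtain p where p: "p \<in> carrier ?M" "a = fp_class P p"
      by (auto simp: fp_ring_carrier)
    then show "c a \<in> carrier R" by (simp add: c)
    fix b assume "b \<in> carrier (fp_ring P)"
    then obtain q where q: "q \<in> carrier ?M" "b = fp_class P q"
      by (auto simp: fp_ring_carrier)
    show "c (a \<otimes>\<^bsub>fp_ring P\<^esub> b) = c a \<otimes>\<^bsub>R\<^esub> c b" "c (a \<oplus>\<^bsub>fp_ring P\<^esub> b) = c a \<oplus>\<^bsub>R\<^esub> c b"
      unfolding p(2) q(2) hom(2)[OF p(1) q(1), symmetric] hom(3)[OF p(1) q(1), symmetric]
      using p q by (simp_all only: c M.m_closed M.a_closed z.hom_mult z.hom_add)
  next
    show "c \<one>\<^bsub>fp_ring P\<^esub> = \<one>\<^bsub>R\<^esub>"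
      using c[OF M.one_closed] ring_hom_one[OF fp_class_hom[OF P]] z.hom_one by simp
  qed
  then have "c \<in> points R P"
    by (simp add: points_def Hom_def c_def)
  moreover have "c (fp_gen P i) = x i" if "i < fst P" for i
    using that c[of "Var \<Z> i"] zeval_Var[OF R xc] by (auto simp: fp_gen_def Var_int_carrier)
  ultimately show ?thesis by blast
qed

section \<open>Primitive positive formulas\<close>

text \<open>The variables \<open>Inl v\<close> are free, the variables \<open>Inr j\<close> are existentially quantified.\<close>

definition sat :: "('a, 'r) ring_scheme \<Rightarrow> ('v + nat) rterm list \<Rightarrow> ('v \<Rightarrow> 'a) \<Rightarrow> bool"
  where "sat R \<Theta> x \<longleftrightarrow>
    (\<exists>y. (\<forall>j. y j \<in> carrier R) \<and> (\<forall>t\<in>set \<Theta>. ev R (case_sum x y) t = \<zero>\<^bsub>R\<^esub>))"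

lemma satI:
  "(\<And>j. y j \<in> carrier R) \<Longrightarrow> (\<And>t. t \<in> set \<Theta> \<Longrightarrow> ev R (case_sum x y) t = \<zero>\<^bsub>R\<^esub>) \<Longrightarrow> sat R \<Theta> x"
  by (auto simp: sat_def)

lemma satE:
  assumes "sat R \<Theta> x"
  obtains y where "\<And>j. y j \<in> carrier R" "\<And>t. t \<in> set \<Theta> \<Longrightarrow> ev R (case_sum x y) t = \<zero>\<^bsub>R\<^esub>"
  using assms by (auto simp: sat_def)

text \<open>Formulas consist of equations only, so the images of witnesses are witnesses.\<close>

lemma sat_hom:
  assumes "ring R" "ring S" "h \<in> ring_hom R S" "\<And>v. x v \<in> carrier R" "sat R \<Theta> x"
  shows "sat S \<Theta> (h \<circ> x)"
proof -
  obtain y where y: "\<And>j. y j \<in> carrier R" "\<And>t. t \<in> set \<Theta> \<Longrightarrow> ev R (case_sum x y) t = \<zero>\<^bsub>R\<^esub>"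
    using assms(5) by (rule satE) blast
  show ?thesis
  proof (rule satI)
    show "(h \<circ> y) j \<in> carrier S" for j
      using y(1) assms(3) by (simp add: ring_hom_closed)
    fix t assume t: "t \<in> set \<Theta>"
    have "h (ev R (case_sum x y) t) = ev S (h \<circ> case_sum x y) t"
      using assms(4) y(1) by (intro ev_hom assms(1-3)) (auto split: sum.split)
    moreover have "h \<circ> case_sum x y = case_sum (h \<circ> x) (h \<circ> y)"
      by (auto split: sum.split)
    ultimately show "ev S (case_sum (h \<circ> x) (h \<circ> y)) t = \<zero>\<^bsub>S\<^esub>"
      using y(2)[OF t] ring_hom_zero[OF assms(3,1,2)] by simp
  qed
qed

definition free_vars :: "('v + nat) rterm list \<Rightarrow> 'v set"
  where "free_vars \<Theta> = {v. \<exists>t\<in>set \<Theta>. Inl v \<in> vars t}"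

lemma finite_free_vars [simp]: "finite (free_vars \<Theta>)"
proof -
  have "free_vars \<Theta> = Inl -` (\<Union>t\<in>set \<Theta>. vars t)"
    by (auto simp: free_vars_def)
  then show ?thesis
    by (auto intro: finite_vimageI)
qed

lemma sat_cong:
  assumes "\<And>v. v \<in> free_vars \<Theta> \<Longrightarrow> x v = x' v"
  shows "sat R \<Theta> x \<longleftrightarrow> sat R \<Theta> x'"
proof -
  have "ev R (case_sum x y) t = ev R (case_sum x' y) t" if "t \<in> set \<Theta>" for y t
    using assms that by (intro ev_cong) (auto simp: free_vars_def split: sum.split)
  then show ?thesis by (simp add: sat_def)
qed

lemma sat_map:
  "sat R (map (map_rterm (map_sum g id)) \<Theta>) x \<longleftrightarrow> sat R \<Theta> (x \<circ> g)"
proof -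
  have "case_sum x y \<circ> map_sum g id = case_sum (x \<circ> g) y" for y :: "nat \<Rightarrow> _"
    by (auto split: sum.split)
  then show ?thesis by (simp add: sat_def ev_map)
qed

section \<open>Primitive morphisms as polynomial maps and as formulas\<close>

definition gen_poly :: "presentation \<Rightarrow> presentation \<Rightarrow> (fp_elem \<Rightarrow> fp_elem) \<Rightarrow> nat \<Rightarrow> nat multiset \<Rightarrow> int"
  where "gen_poly P Q m i = (SOME q. q \<in> carrier (MPoly \<Z> {..<fst Q}) \<and> fp_class Q q = m (fp_gen P i))"

lemma gen_poly:
  assumes "primitive P Q m" "i < fst P"
  shows "gen_poly P Q m i \<in> carrier (MPoly \<Z> {..<fst Q})" "fp_class Q (gen_poly P Q m i) = m (fp_gen P i)"
proof -
  have "m \<in> ring_hom (fp_ring P) (fp_ring Q)" "presentation P"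
    using assms(1) by (auto simp: primitive_def Hom_def)
  then have "m (fp_gen P i) \<in> carrier (fp_ring Q)"
    using assms(2) fp_gen_carrier ring_hom_closed by metis
  then have "\<exists>q. q \<in> carrier (MPoly \<Z> {..<fst Q}) \<and> fp_class Q q = m (fp_gen P i)"
    by (auto simp: fp_ring_carrier)
  from someI_ex[OF this]
  show "gen_poly P Q m i \<in> carrier (MPoly \<Z> {..<fst Q})" "fp_class Q (gen_poly P Q m i) = m (fp_gen P i)"
    unfolding gen_poly_def by blast+
qed

lemma points_map_point:
  assumes m: "primitive P Q m" and e: "e \<in> points R Q"
  shows "points_map P m e \<in> points R P"
proof -
  have "m \<in> ring_hom (fp_ring P) (fp_ring Q)"
    using m by (simp add: primitive_def Hom_def)
  then have hom: "e \<circ> m \<in> ring_hom (fp_ring P) R"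
    using points_hom[OF e] by (rule ring_hom_trans)
  have "cring (fp_ring P)"
    using m by (intro fp_ring_cring) (simp add: primitive_def)
  then interpret cring "fp_ring P" .
  have "restrict (e \<circ> m) (carrier (fp_ring P)) \<in> ring_hom (fp_ring P) R"
    using ring_hom_memE[OF hom] by (intro ring_hom_memI) auto
  then show ?thesis
    by (simp add: points_def Hom_def points_map_def compose_def o_def)
qed

text \<open>The representing polynomials depend only on the morphism, so one formula can describe
  its effect over all rings.\<close>

lemma points_map_gen:
  assumes R: "cring R" and m: "primitive P Q m" and e: "e \<in> points R Q" and i: "i < fst P"
  shows "points_map P m e (fp_gen P i) = zeval R (\<lambda>j. e (fp_gen Q j)) (gen_poly P Q m i)"
proof -
  have PQ: "presentation P" "presentation Q"
    using m by (auto simp: primitive_def)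
  then show ?thesis
    using gen_poly[OF m i] point_fp_class[OF R PQ(2) e] fp_gen_carrier[OF PQ(1) i]
    by (metis compose_eq points_map_def)
qed

lemma ex_image_iff:
  assumes R: "cring R" and m: "primitive P Q m" and c: "c \<in> points R P"
  shows "c \<in> ex_image R P Q m \<longleftrightarrow>
    (\<exists>y\<in>zeros R Q. \<forall>i<fst P. c (fp_gen P i) = zeval R y (gen_poly P Q m i))"
proof
  have PQ: "presentation P" "presentation Q"
    using m by (auto simp: primitive_def)
  {
    assume "c \<in> ex_image R P Q m"
    then obtain e where e: "e \<in> points R Q" "c = points_map P m e"
      by (auto simp: ex_image_def)
    then show "\<exists>y\<in>zeros R Q. \<forall>i<fst P. c (fp_gen P i) = zeval R y (gen_poly P Q m i)"
      using point_zeros[OF R PQ(2) e(1)] points_map_gen[OF R m e(1)] by blast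
  next
    assume "\<exists>y\<in>zeros R Q. \<forall>i<fst P. c (fp_gen P i) = zeval R y (gen_poly P Q m i)"
    then obtain y where y: "y \<in> zeros R Q" "\<And>i. i < fst P \<Longrightarrow> c (fp_gen P i) = zeval R y (gen_poly P Q m i)"
      by blast
    obtain e where e: "e \<in> points R Q" "\<And>j. j < fst Q \<Longrightarrow> e (fp_gen Q j) = y j"
      using point_exists[OF R PQ(2) y(1)] by blast
    have "c = points_map P m e"
    proof (rule point_unique[OF R PQ(1) c points_map_point[OF m e(1)]])
      fix i assume i: "i < fst P"
      have "zeval R (\<lambda>j. e (fp_gen Q j)) (gen_poly P Q m i) = zeval R y (gen_poly P Q m i)"
        using e point_gen_carrier[OF PQ(2) e(1)] by (intro zeval_cong[OF R gen_poly(1)[OF m i]]) auto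
      then show "c (fp_gen P i) = points_map P m e (fp_gen P i)"
        by (simp only: y(2)[OF i] points_map_gen[OF R m e(1) i])
    qed
    then show "c \<in> ex_image R P Q m"
      using e(1) by (auto simp: ex_image_def)
  }
qed

text \<open>Membership in \<open>ex_image\<close> written as a formula: the bound variables are the
  coordinates of a point of \<open>Q\<close>.\<close>

definition morph_terms :: "presentation \<Rightarrow> presentation \<Rightarrow> (fp_elem \<Rightarrow> fp_elem) \<Rightarrow> (nat + nat) rterm list"
  where "morph_terms P Q m =
    map (\<lambda>p. map_rterm Inr (zterm {..<fst Q} p)) (snd Q) @
    map (\<lambda>i. TAdd (TVar (Inl i)) (TNeg (map_rterm Inr (zterm {..<fst Q} (gen_poly P Q m i))))) [0..<fst P]"

lemma (in ring) add_neg_eq_zero_iff: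
  "a \<in> carrier R \<Longrightarrow> b \<in> carrier R \<Longrightarrow> a \<oplus> \<ominus> b = \<zero> \<longleftrightarrow> a = b"
  by (metis minus_equality minus_minus r_neg a_inv_closed)

lemma morph_terms_vanish_iff:
  assumes R: "cring R" and m: "primitive P Q m" and x: "\<And>i. x i \<in> carrier R" and y: "\<And>j. y j \<in> carrier R"
  shows "(\<forall>t\<in>set (morph_terms P Q m). ev R (case_sum x y) t = \<zero>\<^bsub>R\<^esub>) \<longleftrightarrow>
    y \<in> zeros R Q \<and> (\<forall>i<fst P. x i = zeval R y (gen_poly P Q m i))"
proof -
  interpret R: cring R by fact
  have Q: "presentation Q" using m by (simp add: primitive_def)
  have o: "case_sum x y \<circ> Inr = y" by auto
  have z: "ev R y (zterm {..<fst Q} p) = zeval R y p" if "p \<in> carrier (MPoly \<Z> {..<fst Q})" for p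
    using that y by (intro ev_zterm[OF R]) auto
  have "zeval R y (gen_poly P Q m i) \<in> carrier R" if "i < fst P" for i
    using gen_poly(1)[OF m that] y by (intro ring_hom_closed[OF zeval_hom[OF R]]) auto
  then show ?thesis
    using y x presentation_mem[OF Q] gen_poly(1)[OF m]
    by (auto simp: morph_terms_def zeros_def ev_map o z R.add_neg_eq_zero_iff ball_Un)
qed

lemma sat_morph_terms:
  assumes R: "cring R" and m: "primitive P Q m" and x: "\<And>i. x i \<in> carrier R"
  shows "sat R (morph_terms P Q m) x \<longleftrightarrow>
    (\<exists>y\<in>zeros R Q. \<forall>i<fst P. x i = zeval R y (gen_poly P Q m i))"
proof
  interpret R: cring R by fact
  show "\<exists>y\<in>zeros R Q. \<forall>i<fst P. x i = zeval R y (gen_poly P Q m i)" if "sat R (morph_terms P Q m) x"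
    using that morph_terms_vanish_iff[OF assms] by (auto simp: sat_def)
  assume "\<exists>y\<in>zeros R Q. \<forall>i<fst P. x i = zeval R y (gen_poly P Q m i)"
  then obtain y where y: "y \<in> zeros R Q" "\<And>i. i < fst P \<Longrightarrow> x i = zeval R y (gen_poly P Q m i)"
    by blast
  \<comment> \<open>\<open>sat\<close> wants all witnesses in the carrier, but a tuple in
    \<open>zeros\<close> is arbitrary from \<open>fst Q\<close> on; it is cut off by 0.\<close>
  define y' where "y' j = (if j < fst Q then y j else \<zero>\<^bsub>R\<^esub>)" for j
  have yc: "y \<in> {..<fst Q} \<rightarrow> carrier R"
    using y by (simp add: zeros_def)
  have cong: "zeval R y p = zeval R y' p" if "p \<in> carrier (MPoly \<Z> {..<fst Q})" for p
    using that yc by (intro zeval_cong[OF R]) (auto simp: y'_def)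
  have y': "y' j \<in> carrier R" for j
    using yc by (auto simp: y'_def)
  have "presentation Q" using m by (simp add: primitive_def)
  then have "y' \<in> zeros R Q"
    using y(1) y' cong presentation_mem by (auto simp: zeros_def)
  moreover have "x i = zeval R y' (gen_poly P Q m i)" if "i < fst P" for i
    using y(2)[OF that] cong[OF gen_poly(1)[OF m that]] by simp
  ultimately show "sat R (morph_terms P Q m) x"
    using morph_terms_vanish_iff[where x = x and y = y', OF R m x y'] y' by (auto simp: sat_def)
qed

definition zero_terms :: "presentation \<Rightarrow> nat rterm list"
  where "zero_terms P = map (zterm {..<fst P}) (snd P)"

text \<open>This form survives both constructions below: equations pass up along homomorphisms,
  while the formulas in the conclusion are handled by Los's theorem and by reflection.\<close>

lemma model_of_iff:
  assumes R: "cring R" and ax: "arithmetic_axiom (P, F)"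
  shows "model_of R (P, F) \<longleftrightarrow>
    (\<forall>x. (\<forall>i. x i \<in> carrier R) \<longrightarrow> (\<forall>t\<in>set (zero_terms P). ev R x t = \<zero>\<^bsub>R\<^esub>) \<longrightarrow>
      (\<exists>(Q, m)\<in>F. sat R (morph_terms P Q m) x))" (is "_ \<longleftrightarrow> ?rhs")
proof -
  interpret R: cring R by fact
  have P: "presentation P" and m: "\<And>Q m. (Q, m) \<in> F \<Longrightarrow> primitive P Q m"
    using ax by (auto simp: arithmetic_axiom_def)
  \<comment> \<open>One inclusion in \<open>model_of\<close> is automatic, which leaves only the
    covering condition.\<close>
  have ex: "ex_image R P Q m \<subseteq> points R P" if "(Q, m) \<in> F" for Q m
    using points_map_point[OF m[OF that]] by (auto simp: ex_image_def)
  have zt: "(\<forall>t\<in>set (zero_terms P). ev R x t = \<zero>\<^bsub>R\<^esub>) \<longleftrightarrow> x \<in> zeros R P" if "\<And>i. x i \<in> carrier R" for x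
    using that presentation_mem[OF P] by (auto simp: zero_terms_def zeros_def ev_zterm[OF R])
  have "model_of R (P, F) \<longleftrightarrow> (\<forall>c\<in>points R P. \<exists>(Q, m)\<in>F. c \<in> ex_image R P Q m)"
    using ex by (fastforce simp: model_of_def)
  also have "\<dots> \<longleftrightarrow> ?rhs"
  proof (intro iffI ballI allI impI)
    fix x assume *: "\<forall>c\<in>points R P. \<exists>(Q, m)\<in>F. c \<in> ex_image R P Q m"
      and x: "\<forall>i. x i \<in> carrier R" "\<forall>t\<in>set (zero_terms P). ev R x t = \<zero>\<^bsub>R\<^esub>"
    obtain c where c: "c \<in> points R P" "\<And>i. i < fst P \<Longrightarrow> c (fp_gen P i) = x i"
      using point_exists[OF R P] zt x by blast
    then obtain Q m where Qm: "(Q, m) \<in> F" "c \<in> ex_image R P Q m"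
      using * by blast
    then have "sat R (morph_terms P Q m) x"
      using ex_image_iff[OF R m[OF Qm(1)] c(1)] sat_morph_terms[OF R m[OF Qm(1)]] x(1) c(2) by auto
    then show "\<exists>(Q, m)\<in>F. sat R (morph_terms P Q m) x"
      using Qm(1) by blast
  next
    fix c assume *: ?rhs and c: "c \<in> points R P"
    define x where "x i = (if i < fst P then c (fp_gen P i) else \<zero>\<^bsub>R\<^esub>)" for i
    have x: "x i \<in> carrier R" for i
      using point_gen_carrier[OF P c] by (simp add: x_def)
    have "zeval R (\<lambda>i. c (fp_gen P i)) p = zeval R x p" if "p \<in> set (snd P)" for p
      using presentation_mem[OF P that] point_gen_carrier[OF P c]
      by (intro zeval_cong[OF R]) (auto simp: x_def)
    then have "x \<in> zeros R P"
      using point_zeros[OF R P c] x by (auto simp: zeros_def)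
    then obtain Q m where Qm: "(Q, m) \<in> F" "sat R (morph_terms P Q m) x"
      using * x zt by blast
    then have "c \<in> ex_image R P Q m"
      using ex_image_iff[OF R m[OF Qm(1)] c] sat_morph_terms[where x = x, OF R m[OF Qm(1)] x]
      by (auto simp: x_def)
    then show "\<exists>(Q, m)\<in>F. c \<in> ex_image R P Q m"
      using Qm(1) by blast
  qed
  finally show ?thesis .
qed

section \<open>Ultrapowers\<close>

text \<open>Zorn's lemma with the order of filters reversed gives a minimal nontrivial filter below
  \<open>sequentially\<close>. It decides every predicate, since adjoining an undecided one would
  yield a smaller nontrivial filter.\<close>

lemma ex_free_ultrafilter:
  "\<exists>U::nat filter. U \<le> sequentially \<and> U \<noteq> bot \<and> (\<forall>P. eventually P U \<or> eventually (\<lambda>k. \<not> P k) U)"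
proof -
  let ?A = "{F :: nat filter. F \<noteq> bot \<and> F \<le> sequentially}"
  have "\<exists>U\<in>?A. \<forall>F\<in>?A. F \<le> U \<longrightarrow> F = U"
  proof (rule predicate_Zorn)
    show "partial_order_on ?A (relation_of (\<lambda>F G. G \<le> F) ?A)"
      by (auto simp: partial_order_on_def preorder_on_def refl_on_def trans_def antisym_def relation_of_def)
    fix C assume C: "C \<in> Chains (relation_of (\<lambda>F G. G \<le> F) ?A)"
    show "\<exists>U\<in>?A. \<forall>F\<in>C. U \<le> F"
    proof (cases "C = {}")
      case True
      then show ?thesis by (intro bexI[of _ sequentially]) auto
    next
      case False
      have sub: "C \<subseteq> ?A" and lin: "\<And>F G. F \<in> C \<Longrightarrow> G \<in> C \<Longrightarrow> F \<le> G \<or> G \<le> F"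
        using C by (auto simp: Chains_def relation_of_def)
      \<comment> \<open>A chain is directed, so what holds eventually for the infimum already does
        so for some member; in particular \<open>False\<close> does not.\<close>
      have "eventually P (Inf C) \<longleftrightarrow> (\<exists>F\<in>C. eventually P F)" for P
      proof (rule eventually_Inf_base[OF False])
        show "\<exists>H\<in>C. H \<le> inf F G" if "F \<in> C" "G \<in> C" for F G
          using lin[OF that] that by auto
      qed
      from this[of "\<lambda>_. False"] have "Inf C \<noteq> bot"
        using sub by (auto simp: trivial_limit_def)
      moreover have "Inf C \<le> sequentially"
        using False sub by (auto intro: Inf_lower2)
      ultimately show ?thesis
        by (intro bexI[of _ "Inf C"]) (auto intro: Inf_lower)
    qed
  qed
  then obtain U where U: "U \<noteq> bot" "U \<le> sequentially"
    and max: "\<And>F. F \<noteq> bot \<Longrightarrow> F \<le> U \<Longrightarrow> F = U"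
    by (auto intro: order_trans)
  have "eventually P U \<or> eventually (\<lambda>k. \<not> P k) U" for P
  proof (rule disjCI)
    assume "\<not> eventually (\<lambda>k. \<not> P k) U"
    then have "inf U (principal {k. P k}) \<noteq> bot"
      by (simp add: trivial_limit_def eventually_inf_principal)
    then have "inf U (principal {k. P k}) = U"
      by (intro max) auto
    moreover have "eventually P (inf U (principal {k. P k}))"
      by (simp add: eventually_inf_principal)
    ultimately show "eventually P U" by simp
  qed
  with U show ?thesis by blast
qed

section \<open>Ultrapowers of rings and Los's theorem for primitive positive formulas\<close>

definition seq_ring :: "('a, 'r) ring_scheme \<Rightarrow> (nat \<Rightarrow> 'a) ring"
  where "seq_ring R = \<lparr>carrier = UNIV \<rightarrow> carrier R,
    mult = (\<lambda>f g k. f k \<otimes>\<^bsub>R\<^esub> g k), one = (\<lambda>_. \<one>\<^bsub>R\<^esub>),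
    zero = (\<lambda>_. \<zero>\<^bsub>R\<^esub>), add = (\<lambda>f g k. f k \<oplus>\<^bsub>R\<^esub> g k)\<rparr>"

lemma seq_ring_cring:
  assumes "cring R"
  shows "cring (seq_ring R)"
proof -
  interpret cring R by fact
  show ?thesis
  proof (rule cringI)
    show "abelian_group (seq_ring R)"
    proof (rule abelian_groupI)
      show "\<exists>g\<in>carrier (seq_ring R). g \<oplus>\<^bsub>seq_ring R\<^esub> f = \<zero>\<^bsub>seq_ring R\<^esub>"
        if "f \<in> carrier (seq_ring R)" for f
        using that by (intro bexI[of _ "\<lambda>k. \<ominus>\<^bsub>R\<^esub> f k"]) (auto simp: seq_ring_def l_neg Pi_iff)
    qed (auto simp: seq_ring_def a_ac Pi_iff)
    show "comm_monoid (seq_ring R)"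
      by (rule comm_monoidI) (auto simp: seq_ring_def m_ac Pi_iff)
  qed (auto simp: seq_ring_def l_distr Pi_iff)
qed

definition null_ideal :: "('a, 'r) ring_scheme \<Rightarrow> nat filter \<Rightarrow> (nat \<Rightarrow> 'a) set"
  where "null_ideal R U = {f \<in> carrier (seq_ring R). eventually (\<lambda>k. f k = \<zero>\<^bsub>R\<^esub>) U}"

definition ultrapower :: "('a, 'r) ring_scheme \<Rightarrow> nat filter \<Rightarrow> (nat \<Rightarrow> 'a) set ring"
  where "ultrapower R U = seq_ring R Quot null_ideal R U"

definition ultra_class :: "('a, 'r) ring_scheme \<Rightarrow> nat filter \<Rightarrow> (nat \<Rightarrow> 'a) \<Rightarrow> (nat \<Rightarrow> 'a) set"
  where "ultra_class R U f = null_ideal R U +>\<^bsub>seq_ring R\<^esub> f"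

lemma null_ideal:
  assumes "cring R"
  shows "ideal (null_ideal R U) (seq_ring R)"
proof -
  interpret R: cring R by fact
  interpret S: cring "seq_ring R" by (intro seq_ring_cring assms)
  have neg: "(\<ominus>\<^bsub>seq_ring R\<^esub> f) = (\<lambda>k. \<ominus>\<^bsub>R\<^esub> f k)" if "f \<in> carrier (seq_ring R)" for f
    using that by (intro S.minus_equality) (auto simp: seq_ring_def R.l_neg Pi_iff)
  show ?thesis
  proof (rule idealI)
    show "subgroup (null_ideal R U) (add_monoid (seq_ring R))"
    proof (rule S.add.subgroupI)
      show "null_ideal R U \<noteq> {}"
        by (auto simp: null_ideal_def seq_ring_def)
      show "\<ominus>\<^bsub>seq_ring R\<^esub> f \<in> null_ideal R U" if "f \<in> null_ideal R U" for f
        using that S.a_inv_closed[of f]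
        by (auto simp: null_ideal_def neg elim: eventually_mono)
      show "f \<oplus>\<^bsub>seq_ring R\<^esub> g \<in> null_ideal R U" if "f \<in> null_ideal R U" "g \<in> null_ideal R U" for f g
        using that S.a_closed[of f g] eventually_conj[of "\<lambda>k. f k = \<zero>\<^bsub>R\<^esub>" U "\<lambda>k. g k = \<zero>\<^bsub>R\<^esub>"]
        by (auto simp: null_ideal_def seq_ring_def elim!: eventually_mono)
    qed (auto simp: null_ideal_def)
    show "g \<otimes>\<^bsub>seq_ring R\<^esub> f \<in> null_ideal R U" "f \<otimes>\<^bsub>seq_ring R\<^esub> g \<in> null_ideal R U"
      if "f \<in> null_ideal R U" "g \<in> carrier (seq_ring R)" for f g
      using that by (auto simp: null_ideal_def seq_ring_def Pi_iff elim: eventually_mono)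
  qed (rule S.ring_axioms)
qed

lemma ultrapower_cring: "cring R \<Longrightarrow> cring (ultrapower R U)"
  unfolding ultrapower_def by (intro ideal.quotient_is_cring null_ideal seq_ring_cring)

lemma ultra_class_hom: "cring R \<Longrightarrow> ultra_class R U \<in> ring_hom (seq_ring R) (ultrapower R U)"
  unfolding ultrapower_def ultra_class_def[abs_def] by (intro ideal.rcos_ring_hom null_ideal)

lemma ultrapower_carrier: "carrier (ultrapower R U) = ultra_class R U ` (UNIV \<rightarrow> carrier R)"
  by (auto simp: ultrapower_def ultra_class_def FactRing_def A_RCOSETS_def' seq_ring_def)

lemma ultra_class_eq_zero_iff:
  assumes R: "cring R" and f: "f \<in> UNIV \<rightarrow> carrier R"
  shows "ultra_class R U f = \<zero>\<^bsub>ultrapower R U\<^esub> \<longleftrightarrow> eventually (\<lambda>k. f k = \<zero>\<^bsub>R\<^esub>) U"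
proof -
  interpret S: cring "seq_ring R" using R by (rule seq_ring_cring)
  interpret I: ideal "null_ideal R U" "seq_ring R" using R by (rule null_ideal)
  have f': "f \<in> carrier (seq_ring R)"
    using f by (simp add: seq_ring_def)
  have zero: "\<zero>\<^bsub>ultrapower R U\<^esub> = null_ideal R U"
    unfolding ultrapower_def FactRing_def by simp
  have "f \<in> null_ideal R U" if "ultra_class R U f = null_ideal R U"
    using I.a_rcos_self[OF f'] unfolding that[unfolded ultra_class_def] .
  moreover have "ultra_class R U f = null_ideal R U" if "f \<in> null_ideal R U"
    unfolding ultra_class_def using that by (rule I.a_rcos_const)
  ultimately have "ultra_class R U f = \<zero>\<^bsub>ultrapower R U\<^esub> \<longleftrightarrow> f \<in> null_ideal R U"
    unfolding zero by (rule iffI)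
  then show ?thesis
    using f' unfolding null_ideal_def by blast
qed

text \<open>Los's theorem for equations: evaluation of a term commutes with the class map and with
  every projection of the power.\<close>

lemma ev_ultrapower:
  assumes R: "cring R" and g: "\<And>v. g v \<in> UNIV \<rightarrow> carrier R"
  shows "ev (ultrapower R U) (\<lambda>v. ultra_class R U (g v)) t = \<zero>\<^bsub>ultrapower R U\<^esub> \<longleftrightarrow>
    eventually (\<lambda>k. ev R (\<lambda>v. g v k) t = \<zero>\<^bsub>R\<^esub>) U"
proof -
  interpret R: cring R by fact
  interpret S: cring "seq_ring R" using R by (rule seq_ring_cring)
  interpret W: cring "ultrapower R U" using R by (rule ultrapower_cring)
  have g': "g v \<in> carrier (seq_ring R)" for v
    using g by (simp add: seq_ring_def)
  have "ultra_class R U (ev (seq_ring R) g t) = ev (ultrapower R U) (ultra_class R U \<circ> g) t"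
    using g' by (intro ev_hom S.ring_axioms W.ring_axioms ultra_class_hom R)
  moreover have "ev (seq_ring R) g t k = ev R (\<lambda>v. g v k) t" for k
  proof -
    have "(\<lambda>f. f k) \<in> ring_hom (seq_ring R) R"
      by (rule ring_hom_memI) (auto simp: seq_ring_def)
    from ev_hom[OF S.ring_axioms R.ring_axioms this g'] show ?thesis
      by (simp add: o_def)
  qed
  moreover have "ev (seq_ring R) g t \<in> UNIV \<rightarrow> carrier R"
    using S.ev_closed[of t g] g' by (simp add: seq_ring_def)
  ultimately show ?thesis
    using ultra_class_eq_zero_iff[OF R, of "ev (seq_ring R) g t" U] by (simp add: o_def)
qed

text \<open>Conjunctions are finite and witnesses are chosen coordinate by coordinate, so this holds
  for every filter. That \<open>U\<close> is an ultrafilter enters only through disjunctions, in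
  \<open>ultrafilter_finite_Ex\<close>.\<close>

lemma sat_ultrapower:
  assumes R: "cring R" and g: "\<And>v. g v \<in> UNIV \<rightarrow> carrier R"
  shows "sat (ultrapower R U) \<Theta> (\<lambda>v. ultra_class R U (g v)) \<longleftrightarrow>
    eventually (\<lambda>k. sat R \<Theta> (\<lambda>v. g v k)) U"
proof -
  have iff: "(\<forall>t\<in>set \<Theta>. ev (ultrapower R U) (case_sum (\<lambda>v. ultra_class R U (g v)) (\<lambda>j. ultra_class R U (f j))) t
        = \<zero>\<^bsub>ultrapower R U\<^esub>) \<longleftrightarrow>
      eventually (\<lambda>k. \<forall>t\<in>set \<Theta>. ev R (case_sum (\<lambda>v. g v k) (\<lambda>j. f j k)) t = \<zero>\<^bsub>R\<^esub>) U"
    if f: "\<And>j. f j \<in> UNIV \<rightarrow> carrier R" for f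
  proof -
    have "case_sum (\<lambda>v. ultra_class R U (g v)) (\<lambda>j. ultra_class R U (f j)) =
        (\<lambda>v. ultra_class R U (case_sum g f v))"
      "\<And>k. case_sum (\<lambda>v. g v k) (\<lambda>j. f j k) = (\<lambda>v. case_sum g f v k)"
      by (auto simp: fun_eq_iff split: sum.split)
    moreover have "case_sum g f v \<in> UNIV \<rightarrow> carrier R" for v
      using f g by (cases v) auto
    ultimately show ?thesis
      by (simp add: ev_ultrapower[OF R] eventually_ball_finite_distrib)
  qed
  show ?thesis
  proof
    assume "sat (ultrapower R U) \<Theta> (\<lambda>v. ultra_class R U (g v))"
    then obtain y where y: "\<And>j. y j \<in> carrier (ultrapower R U)"
      "\<And>t. t \<in> set \<Theta> \<Longrightarrow> ev (ultrapower R U) (case_sum (\<lambda>v. ultra_class R U (g v)) y) t = \<zero>\<^bsub>ultrapower R U\<^esub>"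
      by (rule satE) blast
    have "\<exists>f. \<forall>j. f j \<in> UNIV \<rightarrow> carrier R \<and> y j = ultra_class R U (f j)"
      using y(1) unfolding ultrapower_carrier by (intro choice) blast
    then obtain f where f: "\<And>j. f j \<in> UNIV \<rightarrow> carrier R" "y = (\<lambda>j. ultra_class R U (f j))"
      by blast
    have "eventually (\<lambda>k. \<forall>t\<in>set \<Theta>. ev R (case_sum (\<lambda>v. g v k) (\<lambda>j. f j k)) t = \<zero>\<^bsub>R\<^esub>) U"
      using y(2)[unfolded f(2)] iff[of f, OF f(1)] by blast
    then show "eventually (\<lambda>k. sat R \<Theta> (\<lambda>v. g v k)) U"
    proof (rule eventually_mono)
      fix k assume "\<forall>t\<in>set \<Theta>. ev R (case_sum (\<lambda>v. g v k) (\<lambda>j. f j k)) t = \<zero>\<^bsub>R\<^esub>"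
      moreover have "f j k \<in> carrier R" for j
        using f(1)[of j] by auto
      ultimately show "sat R \<Theta> (\<lambda>v. g v k)"
        by (intro satI[where y = "\<lambda>j. f j k"]) auto
    qed
  next
    assume *: "eventually (\<lambda>k. sat R \<Theta> (\<lambda>v. g v k)) U"
    \<comment> \<open>In coordinates where the formula fails the witness is 0, which keeps the
      sequences of witnesses inside the carrier.\<close>
    have "\<exists>y. (\<forall>j. y j \<in> carrier R) \<and>
        (sat R \<Theta> (\<lambda>v. g v k) \<longrightarrow> (\<forall>t\<in>set \<Theta>. ev R (case_sum (\<lambda>v. g v k) y) t = \<zero>\<^bsub>R\<^esub>))" for k
    proof (cases "sat R \<Theta> (\<lambda>v. g v k)")
      case True
      then show ?thesis by (auto simp: sat_def)
    next
      case False
      then show ?thesis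
        using R by (intro exI[of _ "\<lambda>_. \<zero>\<^bsub>R\<^esub>"]) (auto simp: cring.cring_simprules)
    qed
    then have "\<exists>f. \<forall>k. (\<forall>j. f k j \<in> carrier R) \<and>
        (sat R \<Theta> (\<lambda>v. g v k) \<longrightarrow> (\<forall>t\<in>set \<Theta>. ev R (case_sum (\<lambda>v. g v k) (f k)) t = \<zero>\<^bsub>R\<^esub>))"
      by (intro choice allI)
    then obtain f where f: "\<And>k j. f k j \<in> carrier R"
      "\<And>k t. sat R \<Theta> (\<lambda>v. g v k) \<Longrightarrow> t \<in> set \<Theta> \<Longrightarrow> ev R (case_sum (\<lambda>v. g v k) (f k)) t = \<zero>\<^bsub>R\<^esub>"
      by blast
    have "eventually (\<lambda>k. \<forall>t\<in>set \<Theta>. ev R (case_sum (\<lambda>v. g v k) (\<lambda>j. f k j)) t = \<zero>\<^bsub>R\<^esub>) U"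
      using * by (rule eventually_mono) (use f(2) in auto)
    then have "\<forall>t\<in>set \<Theta>. ev (ultrapower R U) (case_sum (\<lambda>v. ultra_class R U (g v))
        (\<lambda>j. ultra_class R U (\<lambda>k. f k j))) t = \<zero>\<^bsub>ultrapower R U\<^esub>"
      using iff[of "\<lambda>j k. f k j"] f(1) by auto
    moreover have "ultra_class R U (\<lambda>k. f k j) \<in> carrier (ultrapower R U)" for j
      using f(1) by (auto simp: ultrapower_carrier)
    ultimately show "sat (ultrapower R U) \<Theta> (\<lambda>v. ultra_class R U (g v))"
      by (intro satI) auto
  qed
qed

text \<open>If every \<open>S a\<close> failed on a large set, all of them would fail simultaneously
  on a large set, as \<open>F\<close> is finite.\<close>

lemma ultrafilter_finite_Ex:
  assumes ultra: "\<And>P. eventually P U \<or> eventually (\<lambda>k. \<not> P k) U"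
    and "U \<noteq> bot" "finite F" "eventually (\<lambda>k. \<exists>a\<in>F. S a k) U"
  shows "\<exists>a\<in>F. eventually (S a) U"
proof (rule ccontr)
  assume "\<not> ?thesis"
  then have "\<forall>a\<in>F. eventually (\<lambda>k. \<not> S a k) U"
    using ultra by blast
  then have "eventually (\<lambda>k. \<forall>a\<in>F. \<not> S a k) U"
    using \<open>finite F\<close> by (simp add: eventually_ball_finite_distrib)
  with assms(4) have "eventually (\<lambda>k. False) U"
    by eventually_elim auto
  with \<open>U \<noteq> bot\<close> show False
    by (simp add: trivial_limit_def)
qed

lemma ultrapower_model:
  assumes R: "cring R" and U: "\<And>P. eventually P U \<or> eventually (\<lambda>k. \<not> P k) U" "U \<noteq> bot"
    and T: "\<And>\<chi>. \<chi> \<in> T \<Longrightarrow> arithmetic_axiom \<chi>" "theory_model T R"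
  shows "theory_model T (ultrapower R U)"
  unfolding theory_model_def
proof (intro conjI ballI)
  show W: "cring (ultrapower R U)" using R by (rule ultrapower_cring)
  fix \<chi> assume \<chi>: "\<chi> \<in> T"
  obtain P F where PF: "\<chi> = (P, F)" by fastforce
  have ax: "arithmetic_axiom (P, F)" "model_of R (P, F)"
    using \<chi> T PF by (auto simp: theory_model_def)
  show "model_of (ultrapower R U) \<chi>"
    unfolding PF model_of_iff[OF W ax(1)]
  proof (intro allI impI)
    fix x assume x: "\<forall>i. x i \<in> carrier (ultrapower R U)"
      "\<forall>t\<in>set (zero_terms P). ev (ultrapower R U) x t = \<zero>\<^bsub>ultrapower R U\<^esub>"
    have "\<exists>g. \<forall>i. g i \<in> UNIV \<rightarrow> carrier R \<and> x i = ultra_class R U (g i)"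
      using x(1) unfolding ultrapower_carrier by (intro choice) blast
    then obtain g where g: "\<And>i. g i \<in> UNIV \<rightarrow> carrier R" "x = (\<lambda>i. ultra_class R U (g i))"
      by blast
    have "eventually (\<lambda>k. \<forall>t\<in>set (zero_terms P). ev R (\<lambda>i. g i k) t = \<zero>\<^bsub>R\<^esub>) U"
      using x(2) by (simp add: g(2) ev_ultrapower[OF R g(1)] eventually_ball_finite_distrib)
    then have "eventually (\<lambda>k. \<exists>a\<in>F. sat R (morph_terms P (fst a) (snd a)) (\<lambda>i. g i k)) U"
    proof (rule eventually_mono)
      fix k assume "\<forall>t\<in>set (zero_terms P). ev R (\<lambda>i. g i k) t = \<zero>\<^bsub>R\<^esub>"
      moreover have "\<forall>i. g i k \<in> carrier R"
        using g(1) by auto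
      ultimately show "\<exists>a\<in>F. sat R (morph_terms P (fst a) (snd a)) (\<lambda>i. g i k)"
        using ax(2)[unfolded model_of_iff[OF R ax(1)], rule_format, of "\<lambda>i. g i k"]
        by (auto simp: case_prod_beta)
    qed
    then have "\<exists>a\<in>F. eventually (\<lambda>k. sat R (morph_terms P (fst a) (snd a)) (\<lambda>i. g i k)) U"
      using ax(1) by (intro ultrafilter_finite_Ex[OF U]) (auto simp: arithmetic_axiom_def)
    then show "\<exists>(Q, m)\<in>F. sat (ultrapower R U) (morph_terms P Q m) x"
      by (simp add: g(2) sat_ultrapower[OF R g(1)] case_prod_beta)
  qed
qed

section \<open>Countable existentially closed subrings\<close>

text \<open>Parameters come as finite lists because a countable set has only countably many of
  these, unlike sequences.\<close>

definition list_env :: "('a, 'r) ring_scheme \<Rightarrow> 'a list \<Rightarrow> nat \<Rightarrow> 'a"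
  where "list_env R xs i = (if i < length xs then xs ! i else \<zero>\<^bsub>R\<^esub>)"

definition skolem :: "('a, 'r) ring_scheme \<Rightarrow> (nat + nat) rterm list \<Rightarrow> 'a list \<Rightarrow> nat \<Rightarrow> 'a"
  where "skolem R \<Theta> xs = (SOME y. (\<forall>j. y j \<in> carrier R) \<and>
    (\<forall>t\<in>set \<Theta>. ev R (case_sum (list_env R xs) y) t = \<zero>\<^bsub>R\<^esub>))"

lemma skolem:
  assumes "sat R \<Theta> (list_env R xs)"
  shows "skolem R \<Theta> xs j \<in> carrier R"
    and "t \<in> set \<Theta> \<Longrightarrow> ev R (case_sum (list_env R xs) (skolem R \<Theta> xs)) t = \<zero>\<^bsub>R\<^esub>"
  using someI_ex[OF assms[unfolded sat_def]] unfolding skolem_def by blast+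

text \<open>Downward Loewenheim--Skolem for primitive positive formulas. The guard by
  \<open>sat\<close> matters, since otherwise \<open>skolem\<close> is unspecified and could leave
  the carrier. Inserting 0 provides an environment even for empty \<open>D\<close>.\<close>

primrec skolem_stage :: "('a, 'r) ring_scheme \<Rightarrow> 'a set \<Rightarrow> nat \<Rightarrow> 'a set" where
  "skolem_stage R D 0 = insert \<zero>\<^bsub>R\<^esub> D"
| "skolem_stage R D (Suc n) = skolem_stage R D n \<union>
    (\<Union>\<Theta>. \<Union>xs\<in>{xs \<in> lists (skolem_stage R D n). sat R \<Theta> (list_env R xs)}. range (skolem R \<Theta> xs))"

definition skolem_hull :: "('a, 'r) ring_scheme \<Rightarrow> 'a set \<Rightarrow> 'a set"
  where "skolem_hull R D = (\<Union>n. skolem_stage R D n)"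

lemma countable_skolem_hull:
  assumes "countable D"
  shows "countable (skolem_hull R D)"
proof -
  have "countable (skolem_stage R D n)" for n
  proof (induction n)
    case (Suc n)
    then have "countable {xs \<in> lists (skolem_stage R D n). sat R \<Theta> (list_env R xs)}" for \<Theta>
      by (intro countable_Collect countable_lists)
    then show ?case
      using Suc by (auto intro!: countable_UN)
  qed (use assms in auto)
  then show ?thesis by (auto simp: skolem_hull_def)
qed

lemma skolem_hull_carrier:
  assumes "ring R" "D \<subseteq> carrier R"
  shows "skolem_hull R D \<subseteq> carrier R"
proof -
  have "skolem_stage R D n \<subseteq> carrier R" for n
  proof (induction n)
    case 0
    then show ?case using assms by (auto simp: ring.ring_simprules)
  qed (auto simp: skolem(1))
  then show ?thesis by (auto simp: skolem_hull_def)
qed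

lemma skolem_hull_incl: "D \<subseteq> skolem_hull R D" "\<zero>\<^bsub>R\<^esub> \<in> skolem_hull R D"
proof -
  have "insert \<zero>\<^bsub>R\<^esub> D = skolem_stage R D 0" by simp
  also have "\<dots> \<subseteq> skolem_hull R D"
    unfolding skolem_hull_def by blast
  finally show "D \<subseteq> skolem_hull R D" "\<zero>\<^bsub>R\<^esub> \<in> skolem_hull R D" by auto
qed

text \<open>A list has finitely many entries, so all of them are present at a common stage; the next
  one contains the witnesses.\<close>

lemma skolem_hull_skolem:
  assumes "set xs \<subseteq> skolem_hull R D" "sat R \<Theta> (list_env R xs)"
  shows "skolem R \<Theta> xs j \<in> skolem_hull R D"
proof -
  have mono: "skolem_stage R D k \<subseteq> skolem_stage R D n" if "k \<le> n" for k n
    using that by (rule lift_Suc_mono_le[rotated]) auto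
  have "\<exists>n. set xs \<subseteq> skolem_stage R D n"
    using assms(1)
  proof (induction xs)
    case (Cons a xs)
    then obtain n k where "set xs \<subseteq> skolem_stage R D n" "a \<in> skolem_stage R D k"
      by (auto simp: skolem_hull_def)
    then show ?case
      using mono[of n "max n k"] mono[of k "max n k"] by (intro exI[of _ "max n k"]) auto
  qed auto
  then obtain n where "xs \<in> lists (skolem_stage R D n)" by auto
  then have "skolem R \<Theta> xs j \<in> skolem_stage R D (Suc n)"
    using assms(2) unfolding skolem_stage.simps by blast
  then show ?thesis
    unfolding skolem_hull_def by blast
qed

text \<open>Finitely many variables are free in the formula, so the environment can be truncated to
  a finite list of parameters.\<close>

lemma skolem_hull_sat:
  fixes x :: "nat \<Rightarrow> 'a"
  assumes x: "\<And>v. x v \<in> skolem_hull R D" and sat: "sat R \<Theta> x"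
  obtains y where "\<And>j. y j \<in> skolem_hull R D" "\<And>t. t \<in> set \<Theta> \<Longrightarrow> ev R (case_sum x y) t = \<zero>\<^bsub>R\<^esub>"
proof -
  obtain N where N: "\<And>v. v \<in> free_vars \<Theta> \<Longrightarrow> v < N"
    using finite_nat_set_iff_bounded[of "free_vars \<Theta>"] by auto
  define xs where "xs = map x [0..<N]"
  have env: "list_env R xs v = x v" if "v \<in> free_vars \<Theta>" for v
    using N[OF that] by (simp add: list_env_def xs_def)
  then have sat': "sat R \<Theta> (list_env R xs)"
    using sat sat_cong by metis
  show ?thesis
  proof (rule that)
    have "set xs \<subseteq> skolem_hull R D"
      using x by (auto simp: xs_def)
    then show "skolem R \<Theta> xs j \<in> skolem_hull R D" for j
      using sat' by (rule skolem_hull_skolem)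
    fix t assume t: "t \<in> set \<Theta>"
    have "ev R (case_sum x (skolem R \<Theta> xs)) t = ev R (case_sum (list_env R xs) (skolem R \<Theta> xs)) t"
    proof (rule ev_cong)
      fix v assume v: "v \<in> vars t"
      show "case_sum x (skolem R \<Theta> xs) v = case_sum (list_env R xs) (skolem R \<Theta> xs) v"
      proof (cases v)
        case (Inl a)
        then have "a \<in> free_vars \<Theta>"
          using t v unfolding free_vars_def by blast
        then show ?thesis
          using Inl env by simp
      qed simp
    qed
    then show "ev R (case_sum x (skolem R \<Theta> xs)) t = \<zero>\<^bsub>R\<^esub>"
      using skolem(2)[OF sat' t] by simp
  qed
qed

text \<open>The value of \<open>t\<close> is the only witness \<open>z\<close> of the formula
  \<open>z - t = 0\<close>, so closure under terms is a case of closure under witnesses.\<close>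

lemma skolem_hull_ev:
  fixes x :: "nat \<Rightarrow> 'a"
  assumes R: "ring R" and D: "D \<subseteq> carrier R" and x: "\<And>v. x v \<in> skolem_hull R D"
  shows "ev R x t \<in> skolem_hull R D"
proof -
  interpret R: ring R by fact
  have xc: "x v \<in> carrier R" for v
    using skolem_hull_carrier[OF R D] x by auto
  then have tc: "ev R x t \<in> carrier R"
    by (intro R.ev_closed)
  let ?t = "TAdd (TVar (Inr 0)) (TNeg (map_rterm Inl t)) :: (nat + nat) rterm"
  have Inl: "case_sum x y \<circ> Inl = x" for y :: "nat \<Rightarrow> _" by auto
  have "sat R [?t] x"
    using tc by (intro satI[where y = "\<lambda>_. ev R x t"]) (auto simp: ev_map Inl R.r_neg)
  obtain y where y: "\<And>j. y j \<in> skolem_hull R D" "ev R (case_sum x y) ?t = \<zero>\<^bsub>R\<^esub>"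
    using skolem_hull_sat[OF x \<open>sat R [?t] x\<close>] by (metis list.set_intros(1))
  moreover have "y 0 \<in> carrier R"
    using y(1) skolem_hull_carrier[OF R D] by auto
  ultimately have "y 0 = ev R x t"
    using tc by (simp add: ev_map Inl R.add_neg_eq_zero_iff)
  then show ?thesis using y(1) by metis
qed

lemma skolem_hull_subring:
  assumes R: "ring R" and D: "D \<subseteq> carrier R"
  shows "subring (skolem_hull R D) R"
proof -
  interpret R: ring R by fact
  have ev: "(\<And>v :: nat. x v \<in> skolem_hull R D) \<Longrightarrow> ev R x t \<in> skolem_hull R D" for x t
    using R D by (rule skolem_hull_ev)
  show ?thesis
  proof (rule R.subringI)
    show "\<one>\<^bsub>R\<^esub> \<in> skolem_hull R D"
      using ev[of "\<lambda>_. \<zero>\<^bsub>R\<^esub>" TOne] skolem_hull_incl(2)[where R = R and D = D] by simp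
    fix a assume a: "a \<in> skolem_hull R D"
    show "\<ominus>\<^bsub>R\<^esub> a \<in> skolem_hull R D"
      using ev[of "\<lambda>_. a" "TNeg (TVar 0)"] a by simp
    fix b assume b: "b \<in> skolem_hull R D"
    have env: "(\<lambda>v. if v = 0 then a else b) v \<in> skolem_hull R D" for v :: nat
      using a b by simp
    show "a \<otimes>\<^bsub>R\<^esub> b \<in> skolem_hull R D" "a \<oplus>\<^bsub>R\<^esub> b \<in> skolem_hull R D"
      using ev[of "\<lambda>v. if v = 0 then a else b" "TMul (TVar 0) (TVar 1)", OF env]
        ev[of "\<lambda>v. if v = 0 then a else b" "TAdd (TVar 0) (TVar 1)", OF env] by simp_all
  qed (rule skolem_hull_carrier[OF R D])
qed

section \<open>Countable models over the universe\<close>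

lemma countable_ring_copy:
  fixes R :: "('a, 'r) ring_scheme"
  assumes R: "cring R" and c: "countable (carrier R)" and u: "infinite (UNIV :: 'u set)"
  obtains S :: "'u ring" and h :: "'a \<Rightarrow> 'u" where "cring S" "h \<in> ring_iso R S"
proof -
  interpret R: cring R by fact
  obtain g :: "nat \<Rightarrow> 'u" where g: "inj g"
    using infinite_countable_subset[OF u] by blast
  define h where "h = g \<circ> to_nat_on (carrier R)"
  have "inj_on h (carrier R)"
    unfolding h_def using inj_on_to_nat_on[OF c] g by (auto intro!: comp_inj_on dest: inj_on_subset)
  then have h: "h \<in> ring_iso R (image_ring h R)"
    by (rule inj_imp_image_ring_iso)
  have "cring (image_ring h R)"
    using R.ring_iso_imp_img_cring[OF h] by (simp add: image_ring_def image_group_def monoid.defs)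
  with h show ?thesis using that by blast
qed

text \<open>The converse of \<open>sat_hom\<close>. It replaces elementarity of the embedding and
  suffices for inheriting arithmetic axioms.\<close>

definition reflects_sat :: "('a, 'r) ring_scheme \<Rightarrow> ('b, 's) ring_scheme \<Rightarrow> ('a \<Rightarrow> 'b) \<Rightarrow> bool"
  where "reflects_sat S W \<iota> \<longleftrightarrow>
    (\<forall>\<Theta> (x :: nat \<Rightarrow> 'a). (\<forall>v. x v \<in> carrier S) \<longrightarrow> sat W \<Theta> (\<iota> \<circ> x) \<longrightarrow> sat S \<Theta> x)"

lemma reflects_satD:
  fixes x :: "nat \<Rightarrow> 'a"
  shows "reflects_sat S W \<iota> \<Longrightarrow> (\<And>v. x v \<in> carrier S) \<Longrightarrow> sat W \<Theta> (\<iota> \<circ> x) \<Longrightarrow> sat S \<Theta> x"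
  by (simp add: reflects_sat_def)

text \<open>The Skolem hull of \<open>D\<close> is copied to the type \<open>'u\<close>, and the
  embedding undoes the copying.\<close>

lemma countable_ex_closed_subring:
  fixes W :: "('w, 'r) ring_scheme"
  assumes W: "cring W" and D: "D \<subseteq> carrier W" "countable D" and u: "infinite (UNIV :: 'u set)"
  obtains S :: "'u ring" and \<iota> :: "'u \<Rightarrow> 'w" where "cring S" "\<iota> \<in> ring_hom S W" "inj_on \<iota> (carrier S)"
    "D \<subseteq> \<iota> ` carrier S" "countable (carrier S)"
    "reflects_sat S W \<iota>"
proof -
  interpret W: cring W by fact
  let ?E = "skolem_hull W D"
  define S0 where "S0 = W\<lparr>carrier := ?E\<rparr>"
  have carr: "carrier S0 = ?E" by (simp add: S0_def)
  have S0: "cring S0"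
    unfolding S0_def using skolem_hull_subring[OF W.ring_axioms D(1)] skolem_hull_carrier[OF W.ring_axioms D(1)]
    by (simp add: W.subcringI' flip: W.subcring_iff)
  interpret S0: cring S0 by fact
  have id: "id \<in> ring_hom S0 W"
    using skolem_hull_carrier[OF W.ring_axioms D(1)] by (intro ring_hom_memI) (auto simp: S0_def)
  obtain S :: "'u ring" and h where S: "cring S" and h: "h \<in> ring_iso S0 S"
    using countable_ring_copy[OF S0 _ u] countable_skolem_hull[OF D(2)] carr by metis
  interpret S: cring S by fact
  define \<iota> where "\<iota> = inv_into (carrier S0) h"
  have \<iota>: "\<iota> \<in> ring_iso S S0"
    unfolding \<iota>_def using S0.ring_axioms h by (rule ring_iso_set_sym)
  have \<iota>_hom: "\<iota> \<in> ring_hom S W"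
    using ring_hom_trans[OF _ id, of \<iota> S] \<iota> by (simp add: ring_iso_def)
  have h_hom: "h \<in> ring_hom S0 S" and bij: "bij_betw h (carrier S0) (carrier S)"
    using h by (auto simp: ring_iso_def)
  show ?thesis
  proof (rule that[OF S \<iota>_hom])
    show "inj_on \<iota> (carrier S)" "D \<subseteq> \<iota> ` carrier S"
      using \<iota> skolem_hull_incl(1)[of D W] by (auto simp: ring_iso_def bij_betw_def carr)
    have "countable (h ` carrier S0)"
      using countable_skolem_hull[OF D(2)] by (intro countable_image) (simp add: carr)
    then show "countable (carrier S)"
      using bij by (simp add: bij_betw_def)
    show "reflects_sat S W \<iota>"
      unfolding reflects_sat_def
    proof (intro allI impI)
      fix \<Theta> and x :: "nat \<Rightarrow> 'u"
      assume x: "\<forall>v. x v \<in> carrier S" and sat: "sat W \<Theta> (\<iota> \<circ> x)"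
      have \<iota>x: "(\<iota> \<circ> x) v \<in> ?E" for v
        using x \<iota> by (auto simp: ring_iso_def ring_hom_closed simp flip: carr)
      obtain y where y: "\<And>j. y j \<in> ?E" "\<And>t. t \<in> set \<Theta> \<Longrightarrow> ev W (case_sum (\<iota> \<circ> x) y) t = \<zero>\<^bsub>W\<^esub>"
        using \<iota>x sat by (rule skolem_hull_sat) blast
      \<comment> \<open>The hull has the operations of \<open>W\<close>, so witnesses that lie in it
        work there as well; \<open>h\<close> then moves them to the copy.\<close>
      have "sat S0 \<Theta> (\<iota> \<circ> x)"
      proof (rule satI)
        show "y j \<in> carrier S0" for j
          using y(1) by (simp add: carr)
        fix t assume "t \<in> set \<Theta>"
        moreover have "id (ev S0 (case_sum (\<iota> \<circ> x) y) t) = ev W (id \<circ> case_sum (\<iota> \<circ> x) y) t"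
          using \<iota>x y(1) by (intro ev_hom S0.ring_axioms W.ring_axioms id) (auto simp: carr split: sum.split)
        ultimately show "ev S0 (case_sum (\<iota> \<circ> x) y) t = \<zero>\<^bsub>S0\<^esub>"
          using y(2) by (simp add: S0_def)
      qed
      then have "sat S \<Theta> (h \<circ> (\<iota> \<circ> x))"
        using \<iota>x by (intro sat_hom[OF S0.ring_axioms S.ring_axioms h_hom]) (auto simp: carr)
      moreover have "h \<circ> (\<iota> \<circ> x) = x"
        using x bij by (auto simp: \<iota>_def fun_eq_iff bij_betw_inv_into_right)
      ultimately show "sat S \<Theta> x" by simp
    qed
  qed
qed

section \<open>Complements of primitive positive formulas\<close>

lemma theory_model_ex_closed:
  assumes S: "cring S" and \<iota>: "\<iota> \<in> ring_hom S W"
    and ec: "reflects_sat S W \<iota>"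
    and T: "\<And>\<chi>. \<chi> \<in> T \<Longrightarrow> arithmetic_axiom \<chi>" "theory_model T W"
  shows "theory_model T S"
  unfolding theory_model_def
proof (intro conjI ballI S)
  fix \<chi> assume \<chi>: "\<chi> \<in> T"
  obtain P F where PF: "\<chi> = (P, F)" by fastforce
  have W: "cring W" and ax: "arithmetic_axiom (P, F)" "model_of W (P, F)"
    using \<chi> T PF by (auto simp: theory_model_def)
  interpret S: cring S by fact
  interpret W: cring W by fact
  show "model_of S \<chi>"
    unfolding PF model_of_iff[OF S ax(1)]
  proof (intro allI impI)
    fix x assume x: "\<forall>i. x i \<in> carrier S" "\<forall>t\<in>set (zero_terms P). ev S x t = \<zero>\<^bsub>S\<^esub>"
    \<comment> \<open>The premises of the axiom go up to \<open>W\<close>, where the axiom is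
      applied; reflection brings its conclusion back.\<close>
    have "ev W (\<iota> \<circ> x) t = \<zero>\<^bsub>W\<^esub>" if "t \<in> set (zero_terms P)" for t
      using ev_hom[OF S.ring_axioms W.ring_axioms \<iota>, of t x] x that
        ring_hom_zero[OF \<iota> S.ring_axioms W.ring_axioms] by simp
    moreover have "(\<iota> \<circ> x) i \<in> carrier W" for i
      using x(1) \<iota> by (simp add: ring_hom_closed)
    ultimately obtain Q m where "(Q, m) \<in> F" "sat W (morph_terms P Q m) (\<iota> \<circ> x)"
      using ax(2)[unfolded model_of_iff[OF W ax(1)], rule_format, of "\<iota> \<circ> x"] by blast
    then show "\<exists>(Q, m)\<in>F. sat S (morph_terms P Q m) x"
      using reflects_satD[OF ec, of x] x(1) by blast
  qed
qed

text \<open>Substituting \<open>b\<close> for the free variables turns the formula into a system of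
  polynomials over \<open>B\<close> in the bound variables, and witnesses become common
  zeros.\<close>

lemma existentially_closed_sat:
  assumes B: "cring B" and C: "cring C" and f: "f \<in> ring_hom B C" and ec: "existentially_closed B C f"
    and b: "\<And>v. b v \<in> carrier B" and sat: "sat C \<Theta> (f \<circ> b)"
  shows "sat B \<Theta> b"
proof -
  interpret B: cring B by fact
  interpret C: cring C by fact
  define X where "X = Inr -` (\<Union>t\<in>set \<Theta>. vars t)"
  have "finite X"
    by (auto simp: X_def intro: finite_vimageI)
  let ?M = "MPoly B X"
  interpret M: cring ?M by (rule B.MPoly_cring)
  \<comment> \<open>Free variables become constant polynomials. Bound variables that do not occur
    are sent to 0, as they are not variables of the polynomial ring.\<close>
  define \<sigma> where "\<sigma> = case_sum (\<lambda>v. monomial B (b v) {#}) (\<lambda>j. if j \<in> X then Var B j else \<zero>\<^bsub>?M\<^esub>)"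
  have Var: "Var B j \<in> carrier ?M" if "j \<in> X" for j
    unfolding Var_monomial using that by (intro B.monomial_carrier) auto
  have \<sigma>: "\<sigma> v \<in> carrier ?M" for v
    using b Var M.zero_closed by (auto simp: \<sigma>_def split: sum.split simp del: MPoly_simps)
  \<comment> \<open>Used twice: with \<open>f\<close> into \<open>C\<close> to produce a zero of the
    ideal, and with \<open>id\<close> on \<open>B\<close> to read off witnesses.\<close>
  have key: "mpoly_eval S c (h \<circ> ev ?M \<sigma> t) = ev S (case_sum (h \<circ> b) c) t"
    if S: "cring S" and h: "h \<in> ring_hom B S" and c: "c \<in> X \<rightarrow> carrier S" and t: "t \<in> set \<Theta>"
    for S :: "('x, 'y) ring_scheme" and h c t
  proof -
    interpret pe: poly_eval B S h c X
      using S h c B by (intro poly_eval.intro poly_eval_axioms.intro)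
    have "pe.eval (ev ?M \<sigma> t) = ev S (pe.eval \<circ> \<sigma>) t"
      using \<sigma> by (intro ev_hom M.ring_axioms pe.S.ring_axioms pe.eval_hom)
    also have "\<dots> = ev S (case_sum (h \<circ> b) c) t"
    proof (rule ev_cong)
      fix v assume v: "v \<in> vars t"
      show "(pe.eval \<circ> \<sigma>) v = case_sum (h \<circ> b) c v"
      proof (cases v)
        case (Inl u)
        then show ?thesis using b by (simp add: \<sigma>_def pe.eval_const)
      next
        case (Inr j)
        then have "j \<in> X" using v t unfolding X_def by blast
        then show ?thesis using Inr by (simp add: \<sigma>_def pe.eval_Var)
      qed
    qed
    finally show ?thesis by (simp add: pe.eval_def)
  qed
  define S where "S = ev ?M \<sigma> ` set \<Theta>"
  have S: "finite S" "S \<subseteq> carrier ?M"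
    unfolding S_def using M.ev_closed[OF \<sigma>] by auto
  define I where "I = Idl\<^bsub>?M\<^esub> S"
  obtain c where c: "\<And>j. c j \<in> carrier C" "\<And>t. t \<in> set \<Theta> \<Longrightarrow> ev C (case_sum (f \<circ> b) c) t = \<zero>\<^bsub>C\<^esub>"
    using sat by (rule satE) blast
  have cX: "c \<in> X \<rightarrow> carrier C" using c(1) by auto
  interpret pe: poly_eval B C f c X
    using B C f cX by (intro poly_eval.intro poly_eval_axioms.intro)
  interpret z: ring_hom_ring ?M C pe.eval
    by (intro ring_hom_ringI2 M.ring_axioms C.ring_axioms pe.eval_hom)
  \<comment> \<open>The whole ideal must vanish, not just its generators; the kernel of evaluation
    is an ideal containing them.\<close>
  have "I \<subseteq> a_kernel ?M C pe.eval"
    unfolding I_def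
  proof (rule M.genideal_minimal)
    show "ideal (a_kernel ?M C pe.eval) ?M"
      by (rule z.kernel_is_ideal)
    have "pe.eval (ev ?M \<sigma> t) = \<zero>\<^bsub>C\<^esub>" if "t \<in> set \<Theta>" for t
      unfolding pe.eval_def key[OF C f cX that] using that by (rule c(2))
    then have "pe.eval s = \<zero>\<^bsub>C\<^esub>" if "s \<in> S" for s
      using that unfolding S_def by blast
    then show "S \<subseteq> a_kernel ?M C pe.eval"
      using S(2) unfolding a_kernel_def' by blast
  qed
  then have "\<forall>p\<in>I. mpoly_eval C c (f \<circ> p) = \<zero>\<^bsub>C\<^esub>"
    unfolding a_kernel_def' pe.eval_def by blast
  then have "\<exists>c\<in>X \<rightarrow> carrier C. \<forall>p\<in>I. mpoly_eval C c (f \<circ> p) = \<zero>\<^bsub>C\<^esub>"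
    using cX by blast
  moreover have "\<exists>S. finite S \<and> S \<subseteq> carrier ?M \<and> I = Idl\<^bsub>?M\<^esub> S"
    using S I_def by blast
  ultimately have "\<exists>d\<in>X \<rightarrow> carrier B. \<forall>p\<in>I. mpoly_eval B d p = \<zero>\<^bsub>B\<^esub>"
    using ec[unfolded existentially_closed_def, rule_format, OF \<open>finite X\<close>, of I] by blast
  then obtain d where d: "d \<in> X \<rightarrow> carrier B" "\<And>p. p \<in> I \<Longrightarrow> mpoly_eval B d p = \<zero>\<^bsub>B\<^esub>"
    by blast
  \<comment> \<open>The zero is controlled only on \<open>X\<close>, while \<open>sat\<close> wants
    a total tuple in the carrier.\<close>
  define y where "y j = (if j \<in> X then d j else \<zero>\<^bsub>B\<^esub>)" for j
  show ?thesis
  proof (rule satI)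
    show "y j \<in> carrier B" for j
      using d(1) by (auto simp: y_def)
    fix t assume t: "t \<in> set \<Theta>"
    have "ev ?M \<sigma> t \<in> I"
      unfolding I_def using M.genideal_self[OF S(2)] t by (auto simp: S_def)
    then have "\<zero>\<^bsub>B\<^esub> = ev B (case_sum b d) t"
      using key[OF B id_ring_hom d(1) t] d(2) by simp
    also have "\<dots> = ev B (case_sum b y) t"
    proof (rule ev_cong)
      fix v assume v: "v \<in> vars t"
      show "case_sum b d v = case_sum b y v"
      proof (cases v)
        case (Inr j)
        then have "j \<in> X" using v t unfolding X_def by blast
        then show ?thesis using Inr by (simp add: y_def)
      qed simp
    qed
    finally show "ev B (case_sum b y) t = \<zero>\<^bsub>B\<^esub>" by simp
  qed
qed

text \<open>The finite parts of the positive diagram of \<open>B\<close>, together with \<open>\<Theta>\<close>, are realised in \<open>A\<close>,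
  hence the whole diagram is realised in an ultrapower.\<close>

lemma ex_hom_ultrapower_sat:
  assumes A: "cring A" and B: "cring B" and cB: "countable (carrier B)"
    and U: "U \<le> sequentially" "U \<noteq> bot" and b: "\<And>v. b v \<in> carrier B"
    and ext: "\<And>\<psi>. sat B \<psi> b \<Longrightarrow> \<exists>x. (\<forall>v. x v \<in> carrier A) \<and> sat A \<Theta> x \<and> sat A \<psi> x"
  shows "\<exists>f\<in>ring_hom B (ultrapower A U). sat (ultrapower A U) \<Theta> (f \<circ> (b :: nat \<Rightarrow> 'b))"
proof -
  interpret A: cring A by fact
  interpret B: cring B by fact
  define W where "W = ultrapower A U"
  have W: "cring W" unfolding W_def using A by (rule ultrapower_cring)
  interpret W: cring W by fact
  have ne: "carrier B \<noteq> {}" using B.zero_closed by blast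
  \<comment> \<open>The bound variable \<open>j\<close> names the element \<open>e j\<close>, so the
    diagram of \<open>B\<close> becomes a set of equations in bound variables; \<open>n\<close>
    picks a name for each element.\<close>
  define e where "e = from_nat_into (carrier B)"
  have e: "e j \<in> carrier B" for j
    unfolding e_def using ne by (rule from_nat_into)
  define n where "n = to_nat_on (carrier B)"
  have en: "e (n a) = a" if "a \<in> carrier B" for a
    unfolding e_def n_def using cB that by (rule from_nat_into_to_nat_on)
  \<comment> \<open>The part of the diagram found among the first \<open>k\<close> terms of the
    enumeration.\<close>
  define \<psi> where "\<psi> k = filter (\<lambda>t. ev B (case_sum b e) t = \<zero>\<^bsub>B\<^esub>) (map from_nat [0..<k])" for k
  have "\<exists>x y. (\<forall>v. x v \<in> carrier A) \<and> sat A \<Theta> x \<and> (\<forall>j. y j \<in> carrier A) \<and>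
      (\<forall>t\<in>set (\<psi> k). ev A (case_sum x y) t = \<zero>\<^bsub>A\<^esub>)" for k
  proof -
    have "sat B (\<psi> k) b"
      using e by (intro satI[where y = e]) (auto simp: \<psi>_def)
    from ext[OF this] show ?thesis
      unfolding sat_def[of A "\<psi> k"] by blast
  qed
  then obtain X Y where XY: "\<And>k v. X k v \<in> carrier A" "\<And>k. sat A \<Theta> (X k)" "\<And>k j. Y k j \<in> carrier A"
    "\<And>k t. t \<in> set (\<psi> k) \<Longrightarrow> ev A (case_sum (X k) (Y k)) t = \<zero>\<^bsub>A\<^esub>"
    by metis
  define x where "x v = ultra_class A U (\<lambda>k. X k v)" for v
  define y where "y j = ultra_class A U (\<lambda>k. Y k j)" for j
  have carr: "x v \<in> carrier W" "y j \<in> carrier W" for v j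
    using XY by (auto simp: x_def y_def W_def ultrapower_carrier)
  have diagram: "ev W (case_sum x y) t = \<zero>\<^bsub>W\<^esub>" if t: "ev B (case_sum b e) t = \<zero>\<^bsub>B\<^esub>" for t
  proof -
    let ?g = "case_sum (\<lambda>v k. X k v) (\<lambda>j k. Y k j)"
    have g: "?g v \<in> UNIV \<rightarrow> carrier A" for v
      using XY by (cases v) auto
    have "case_sum x y = (\<lambda>v. ultra_class A U (?g v))" "\<And>k. case_sum (X k) (Y k) = (\<lambda>v. ?g v k)"
      by (auto simp: x_def y_def fun_eq_iff split: sum.split)
    \<comment> \<open>A given term belongs to \<open>\<psi> k\<close> for all large
      \<open>k\<close>, and \<open>U\<close> contains every cofinite set.\<close>
    moreover have "eventually (\<lambda>k. ev A (case_sum (X k) (Y k)) t = \<zero>\<^bsub>A\<^esub>) U"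
    proof (rule filter_leD[OF U(1)])
      show "eventually (\<lambda>k. ev A (case_sum (X k) (Y k)) t = \<zero>\<^bsub>A\<^esub>) sequentially"
        using eventually_gt_at_top[of "to_nat t"]
      proof (rule eventually_mono)
        fix k assume "to_nat t < k"
        then have "t \<in> set (\<psi> k)"
          using t by (auto simp: \<psi>_def intro!: image_eqI[of _ _ "to_nat t"])
        then show "ev A (case_sum (X k) (Y k)) t = \<zero>\<^bsub>A\<^esub>" by (rule XY(4))
      qed
    qed
    ultimately show ?thesis
      unfolding W_def by (simp add: ev_ultrapower[OF A g])
  qed
  \<comment> \<open>An equation between two terms is the vanishing of their difference, to which
    \<open>diagram\<close> applies.\<close>
  have transfer: "ev W (case_sum x y) s = ev W (case_sum x y) t"
    if "ev B (case_sum b e) s = ev B (case_sum b e) t" for s t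
  proof -
    have "ev B (case_sum b e) r \<in> carrier B" "ev W (case_sum x y) r \<in> carrier W" for r
      using b e carr by (auto intro!: B.ev_closed W.ev_closed split: sum.split)
    then show ?thesis
      using that diagram[of "TAdd s (TNeg t)"] by (simp add: B.add_neg_eq_zero_iff W.add_neg_eq_zero_iff)
  qed
  \<comment> \<open>Sends an element to the value of its name. The laws of \<open>B\<close> relating
    named elements are equations of the diagram, so they hold in \<open>W\<close>.\<close>
  define f where "f a = y (n a)" for a
  have "f \<in> ring_hom B W"
  proof (rule ring_hom_memI)
    fix a a' assume aa: "a \<in> carrier B" "a' \<in> carrier B"
    show "f (a \<otimes>\<^bsub>B\<^esub> a') = f a \<otimes>\<^bsub>W\<^esub> f a'"
      using transfer[of "TVar (Inr (n (a \<otimes>\<^bsub>B\<^esub> a')))" "TMul (TVar (Inr (n a))) (TVar (Inr (n a')))"] aa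
      by (simp add: en f_def)
    show "f (a \<oplus>\<^bsub>B\<^esub> a') = f a \<oplus>\<^bsub>W\<^esub> f a'"
      using transfer[of "TVar (Inr (n (a \<oplus>\<^bsub>B\<^esub> a')))" "TAdd (TVar (Inr (n a))) (TVar (Inr (n a')))"] aa
      by (simp add: en f_def)
  next
    show "f \<one>\<^bsub>B\<^esub> = \<one>\<^bsub>W\<^esub>"
      using transfer[of "TVar (Inr (n \<one>\<^bsub>B\<^esub>))" TOne] by (simp add: en f_def)
  qed (simp add: f_def carr)
  \<comment> \<open>Each \<open>b v\<close> has two names, a free variable and a bound one; the
    diagram equates them.\<close>
  moreover have "f \<circ> b = x"
    using transfer[of "TVar (Inr (n (b _)))" "TVar (Inl _)"] b by (auto simp: f_def en)
  moreover have "sat W \<Theta> x"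
    unfolding W_def x_def using XY(1,2) by (subst sat_ultrapower[OF A]) auto
  ultimately show ?thesis
    unfolding W_def by auto
qed

text \<open>Turns a homomorphism into the ultrapower into one between rings over the universe, where
  model completeness applies.\<close>

lemma factor_ring_hom:
  assumes "f \<in> ring_hom B W" "\<kappa> \<in> ring_hom C W" "inj_on \<kappa> (carrier C)" "f ` carrier B \<subseteq> \<kappa> ` carrier C"
    and "ring C"
  obtains g where "g \<in> ring_hom B C" "\<And>a. a \<in> carrier B \<Longrightarrow> \<kappa> (g a) = f a"
proof
  interpret C: ring C by fact
  let ?g = "inv_into (carrier C) \<kappa> \<circ> f"
  have mem: "?g a \<in> carrier C" and eq: "\<kappa> (?g a) = f a" if "a \<in> carrier B" for a
  proof -
    have "f a \<in> \<kappa> ` carrier C" using that assms(4) by blast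
    then show "?g a \<in> carrier C" "\<kappa> (?g a) = f a"
      by (simp_all add: inv_into_into f_inv_into_f)
  qed
  have inj: "?g a = c" if "c \<in> carrier C" "f a = \<kappa> c" for a c
    using that assms(3) by (simp add: inv_into_f_f)
  note f = ring_hom_memE[OF assms(1)] and \<kappa> = ring_hom_memE[OF assms(2)]
  show "?g \<in> ring_hom B C"
  proof (rule ring_hom_memI)
    fix a a' assume aa: "a \<in> carrier B" "a' \<in> carrier B"
    show "?g a \<in> carrier C" using aa(1) by (rule mem)
    show "?g (a \<otimes>\<^bsub>B\<^esub> a') = ?g a \<otimes>\<^bsub>C\<^esub> ?g a'"
      using aa mem eq by (intro inj) (simp_all only: f(2) \<kappa>(2) C.m_closed)
    show "?g (a \<oplus>\<^bsub>B\<^esub> a') = ?g a \<oplus>\<^bsub>C\<^esub> ?g a'"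
      using aa mem eq by (intro inj) (simp_all only: f(3) \<kappa>(3) C.a_closed)
  next
    show "?g \<one>\<^bsub>B\<^esub> = \<one>\<^bsub>C\<^esub>"
      by (intro inj) (simp_all only: f(4) \<kappa>(4) C.one_closed)
  qed
  show "\<And>a. a \<in> carrier B \<Longrightarrow> \<kappa> (?g a) = f a" by (rule eq)
qed

lemma sat_complement_nat:
  fixes A :: "('a, 'r) ring_scheme" and \<Theta> :: "(nat + nat) rterm list"
  assumes u: "infinite (UNIV :: 'u set)" and gc: "geometrically_closed TYPE('u) A"
  shows "\<exists>\<Psi>. finite \<Psi> \<and> (\<forall>x. (\<forall>v. x v \<in> carrier A) \<longrightarrow> (sat A \<Theta> x \<longleftrightarrow> \<not> (\<exists>\<psi>\<in>\<Psi>. sat A \<psi> x)))"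
proof -
  have A: "cring A" and mc: "model_complete TYPE('u) (Th A)"
    using gc by (auto simp: geometrically_closed_def)
  have T: "\<And>\<chi>. \<chi> \<in> Th A \<Longrightarrow> arithmetic_axiom \<chi>" "theory_model (Th A) A"
    using A by (auto simp: Th_def theory_model_def)
  obtain U :: "nat filter" where U: "U \<le> sequentially" "U \<noteq> bot"
    and ultra: "\<And>P. eventually P U \<or> eventually (\<lambda>k. \<not> P k) U"
    using ex_free_ultrafilter by blast
  define W where "W = ultrapower A U"
  have W: "cring W" unfolding W_def using A by (rule ultrapower_cring)
  have TW: "theory_model (Th A) W"
    unfolding W_def using ultrapower_model[OF A ultra U(2) T] .
  \<comment> \<open>All candidates for pieces of the complement; an initial segment of the
    enumeration will turn out to suffice.\<close>
  define \<Psi> where "\<Psi> = {\<psi>. \<forall>x. (\<forall>v. x v \<in> carrier A) \<longrightarrow> \<not> (sat A \<Theta> x \<and> sat A \<psi> x)}"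
  have "\<exists>n. \<forall>x. (\<forall>v. x v \<in> carrier A) \<longrightarrow> sat A \<Theta> x \<or> (\<exists>\<psi>\<in>\<Psi> \<inter> from_nat ` {..<n}. sat A \<psi> x)"
  proof (rule ccontr)
    assume "\<not> ?thesis"
    then have "\<forall>n. \<exists>x. (\<forall>v. x v \<in> carrier A) \<and> \<not> sat A \<Theta> x \<and> (\<forall>\<psi>\<in>\<Psi> \<inter> from_nat ` {..<n}. \<not> sat A \<psi> x)"
      by blast
    from choice[OF this] obtain X where X: "\<And>n v. X n v \<in> carrier A" "\<And>n. \<not> sat A \<Theta> (X n)"
      "\<And>n \<psi>. \<psi> \<in> \<Psi> \<inter> from_nat ` {..<n} \<Longrightarrow> \<not> sat A \<psi> (X n)"
      by blast
    define a where "a v = ultra_class A U (\<lambda>k. X k v)" for v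
    have satW: "sat W \<psi> a \<longleftrightarrow> eventually (\<lambda>k. sat A \<psi> (X k)) U" for \<psi>
      unfolding W_def a_def using X(1) by (subst sat_ultrapower[OF A]) auto
    have aW: "range a \<subseteq> carrier W"
      using X(1) by (auto simp: a_def W_def ultrapower_carrier)
    have no\<Theta>: "\<not> sat W \<Theta> a"
      using satW[of \<Theta>] X(2) U(2) by (simp add: trivial_limit_def)
    have no\<Psi>: "\<not> sat W \<psi> a" if \<psi>: "\<psi> \<in> \<Psi>" for \<psi>
    proof
      assume "sat W \<psi> a"
      then have ev1: "eventually (\<lambda>k. sat A \<psi> (X k)) U"
        by (simp add: satW)
      \<comment> \<open>From this index on, \<open>X k\<close> was chosen to violate the formula as
        well.\<close>
      have ev2: "eventually (\<lambda>k. to_nat \<psi> < k) U"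
        using filter_leD[OF U(1) eventually_gt_at_top] .
      have "eventually (\<lambda>k. False) U"
        using ev1 ev2
      proof eventually_elim
        case (elim k)
        have "\<psi> \<in> from_nat ` {..<k}"
          using elim(2) by (intro image_eqI[of _ _ "to_nat \<psi>"]) auto
        then show ?case
          using X(3)[of \<psi> k] \<psi> elim(1) by blast
      qed
      with U(2) show False by (simp add: trivial_limit_def)
    qed
    have "countable (range a)" by simp
    then obtain B :: "'u ring" and \<iota> where B: "cring B" and \<iota>: "\<iota> \<in> ring_hom B W" and "inj_on \<iota> (carrier B)"
      and aB: "range a \<subseteq> \<iota> ` carrier B" and cB: "countable (carrier B)"
      and ecB: "reflects_sat B W \<iota>"
      by (rule countable_ex_closed_subring[OF W aW _ u])
    have TB: "theory_model (Th A) B"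
      using theory_model_ex_closed[OF B \<iota> ecB T(1) TW] .
    have "\<exists>c. c \<in> carrier B \<and> \<iota> c = a v" for v
    proof -
      have "a v \<in> \<iota> ` carrier B" using aB by blast
      then show ?thesis by auto
    qed
    then have "\<exists>b. \<forall>v. b v \<in> carrier B \<and> \<iota> (b v) = a v"
      by (intro choice allI)
    then obtain b where b: "\<And>v. b v \<in> carrier B" "\<iota> \<circ> b = a"
      by (auto simp: fun_eq_iff)
    have satB: "sat W \<psi> a" if "sat B \<psi> b" for \<psi>
      using sat_hom[OF _ _ \<iota> b(1) that] b(2) B W by (simp add: cring_def)
    \<comment> \<open>A formula true of \<open>b\<close> holds of \<open>a\<close> in the
      ultrapower, hence is not in \<open>\<Psi>\<close>, which means that it is compatible with
      \<open>\<Theta>\<close> in \<open>A\<close>.\<close>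
    have "\<exists>x. (\<forall>v. x v \<in> carrier A) \<and> sat A \<Theta> x \<and> sat A \<psi> x" if "sat B \<psi> b" for \<psi>
      using satB[OF that] no\<Psi> by (auto simp: \<Psi>_def)
    from ex_hom_ultrapower_sat[where b = b, OF A B cB U b(1) this]
    obtain f where f: "f \<in> ring_hom B W" "sat W \<Theta> (f \<circ> b)"
      by (auto simp: W_def)
    have fW: "f ` carrier B \<subseteq> carrier W" and cf: "countable (f ` carrier B)"
      using f(1) cB by (auto simp: ring_hom_closed)
    \<comment> \<open>A second hull in the same ultrapower, now around the image of
      \<open>f\<close>; the embedding of \<open>B\<close> and the map \<open>f\<close> may well
      differ.\<close>
    obtain C :: "'u ring" and \<kappa> where C: "cring C" and \<kappa>: "\<kappa> \<in> ring_hom C W" "inj_on \<kappa> (carrier C)"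
      "f ` carrier B \<subseteq> \<kappa> ` carrier C" and "countable (carrier C)"
      and ecC: "reflects_sat C W \<kappa>"
      by (rule countable_ex_closed_subring[OF W fW cf u])
    have TC: "theory_model (Th A) C"
      using theory_model_ex_closed[OF C \<kappa>(1) ecC T(1) TW] .
    obtain g where g: "g \<in> ring_hom B C" "\<And>a. a \<in> carrier B \<Longrightarrow> \<kappa> (g a) = f a"
      using factor_ring_hom[OF f(1) \<kappa>] C by (auto simp: cring_def)
    have "\<kappa> \<circ> (g \<circ> b) = f \<circ> b"
      using g(2) b(1) by (simp add: fun_eq_iff)
    then have satC: "sat C \<Theta> (g \<circ> b)"
      using f(2) g(1) b(1) by (intro reflects_satD[OF ecC]) (auto simp: ring_hom_closed)
    have ec: "existentially_closed B C g"
      using mc[unfolded model_complete_def, rule_format, OF TB TC g(1)] .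
    have "sat B \<Theta> b"
      by (rule existentially_closed_sat[OF B C g(1) ec]) (fact b(1) satC)+
    from satB[OF this] no\<Theta> show False by contradiction
  qed
  then obtain n where n: "\<forall>x. (\<forall>v. x v \<in> carrier A) \<longrightarrow>
      sat A \<Theta> x \<or> (\<exists>\<psi>\<in>\<Psi> \<inter> from_nat ` {..<n}. sat A \<psi> x)"
    by (elim exE)
  show ?thesis
  proof (intro exI conjI allI impI)
    show "finite (\<Psi> \<inter> from_nat ` {..<n})" by simp
    fix x :: "nat \<Rightarrow> 'a" assume x: "\<forall>v. x v \<in> carrier A"
    have "\<not> (sat A \<Theta> x \<and> sat A \<psi> x)" if "\<psi> \<in> \<Psi>" for \<psi>
      using that x unfolding \<Psi>_def by blast
    then show "sat A \<Theta> x \<longleftrightarrow> \<not> (\<exists>\<psi>\<in>\<Psi> \<inter> from_nat ` {..<n}. sat A \<psi> x)"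
      using n[THEN spec, THEN mp, OF x] by (meson IntD1)
  qed
qed

text \<open>With parameters the variables may form an uncountable type. The finitely many that are
  free in the formula are renamed to numbers, and the resulting formulas are renamed back.\<close>

lemma sat_complement:
  fixes A :: "('a, 'r) ring_scheme" and \<Theta> :: "('v + nat) rterm list"
  assumes "infinite (UNIV :: 'u set)" and "geometrically_closed TYPE('u) A"
  shows "\<exists>\<Psi>. finite \<Psi> \<and> (\<forall>x. (\<forall>v. x v \<in> carrier A) \<longrightarrow> (sat A \<Theta> x \<longleftrightarrow> \<not> (\<exists>\<psi>\<in>\<Psi>. sat A \<psi> x)))"
proof -
  define g where "g = to_nat_on (free_vars \<Theta>)"
  define h where "h = from_nat_into (free_vars \<Theta>)"
  have hg: "h (g v) = v" if "v \<in> free_vars \<Theta>" for v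
    unfolding g_def h_def using that by (intro from_nat_into_to_nat_on countable_finite) auto
  obtain \<Psi> where \<Psi>: "finite \<Psi>" "\<And>x. (\<And>v. x v \<in> carrier A) \<Longrightarrow>
      sat A (map (map_rterm (map_sum g id)) \<Theta>) x \<longleftrightarrow> \<not> (\<exists>\<psi>\<in>\<Psi>. sat A \<psi> x)"
    using sat_complement_nat[OF assms, of "map (map_rterm (map_sum g id)) \<Theta>"] by blast
  show ?thesis
  proof (intro exI conjI allI impI)
    show "finite (map (map_rterm (map_sum h id)) ` \<Psi>)" using \<Psi>(1) by simp
    fix x :: "'v \<Rightarrow> 'a" assume x: "\<forall>v. x v \<in> carrier A"
    have "sat A \<Theta> x \<longleftrightarrow> sat A \<Theta> (x \<circ> h \<circ> g)"
      by (rule sat_cong) (simp add: hg)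
    also have "\<dots> \<longleftrightarrow> sat A (map (map_rterm (map_sum g id)) \<Theta>) (x \<circ> h)"
      by (rule sat_map[symmetric])
    also have "\<dots> \<longleftrightarrow> \<not> (\<exists>\<psi>\<in>\<Psi>. sat A \<psi> (x \<circ> h))"
      using x by (intro \<Psi>(2)) simp
    finally show "sat A \<Theta> x \<longleftrightarrow> \<not> (\<exists>\<psi>\<in>map (map_rterm (map_sum h id)) ` \<Psi>. sat A \<psi> x)"
      unfolding bex_simps sat_map .
  qed
qed

section \<open>Positively definable sets\<close>

text \<open>Elements of \<open>A\<close> serve as constants: the free variables are the generators of \<open>P\<close> and
  the elements of \<open>A\<close>, all interpreted by \<open>0\<close> where they are meaningless.\<close>

definition penv :: "('a, 'r) ring_scheme \<Rightarrow> presentation \<Rightarrow> (fp_elem \<Rightarrow> 'a) \<Rightarrow> nat + 'a \<Rightarrow> 'a"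
  where "penv A P c = case_sum (\<lambda>i. if i < fst P then c (fp_gen P i) else \<zero>\<^bsub>A\<^esub>)
    (\<lambda>a. if a \<in> carrier A then a else \<zero>\<^bsub>A\<^esub>)"

definition pp_set :: "('a, 'r) ring_scheme \<Rightarrow> presentation \<Rightarrow> ((nat + 'a) + nat) rterm list \<Rightarrow> (fp_elem \<Rightarrow> 'a) set"
  where "pp_set A P \<Theta> = {c \<in> points A P. sat A \<Theta> (penv A P c)}"

lemma penv_carrier:
  assumes "cring A" "presentation P" "c \<in> points A P"
  shows "penv A P c v \<in> carrier A"
proof -
  interpret cring A by fact
  show ?thesis
    using point_gen_carrier[OF assms(2,3)] by (auto simp: penv_def split: sum.split)
qed

text \<open>The new variables satisfy no relations, so on points this morphism is the projection
  forgetting them. It arises from the universal property: the old generators form a zero of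
  \<open>P\<close> in the larger ring.\<close>

lemma extend_presentation:
  assumes P: "presentation P" and le: "fst P \<le> N"
  defines "Q \<equiv> (N, snd P)"
  shows "\<exists>m. primitive P Q m \<and> (\<forall>i<fst P. m (fp_gen P i) = fp_gen Q i)"
proof -
  have Q: "presentation Q"
    using P le by (fastforce simp: Q_def presentation_def MPoly_carrier)
  have B: "cring (fp_ring Q)" using Q by (rule fp_ring_cring)
  \<comment> \<open>The identity is a point of \<open>Q\<close> over its own ring; its coordinates
    are the generators.\<close>
  define c where "c = restrict id (carrier (fp_ring Q))"
  have "c \<in> points (fp_ring Q) Q"
    using B by (auto simp: points_def Hom_def c_def ring_hom_def cring.cring_simprules)
  from point_zeros[OF B Q this] have "(\<lambda>i. c (fp_gen Q i)) \<in> zeros (fp_ring Q) P"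
    using le by (auto simp: zeros_def Q_def)
  then obtain m where m: "m \<in> points (fp_ring Q) P" "\<And>i. i < fst P \<Longrightarrow> m (fp_gen P i) = c (fp_gen Q i)"
    using point_exists[OF B P] by blast
  have "c (fp_gen Q i) = fp_gen Q i" if "i < fst P" for i
    using fp_gen_carrier[OF Q, of i] that le by (simp add: c_def Q_def)
  then show ?thesis
    using m P Q by (intro exI[of _ m]) (simp add: primitive_def points_def)
qed

text \<open>Bound variables become additional coordinates: the set is the projection of an affine
  variety.\<close>

lemma pos_definable_pp_set:
  assumes A: "cring A" and P: "presentation P"
  shows "pos_definable A P (pp_set A P \<Theta>)"
proof -
  interpret A: cring A by fact
  let ?n = "fst P"
  have "finite (Inr -` (\<Union>t\<in>set \<Theta>. vars t))"
    by (intro finite_vimageI) auto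
  \<comment> \<open>As many new coordinates as are needed to cover the bound variables that
    occur.\<close>
  then obtain k where k: "\<And>j t. t \<in> set \<Theta> \<Longrightarrow> Inr j \<in> vars t \<Longrightarrow> j < k"
    unfolding finite_nat_set_iff_bounded by blast
  define Q where "Q = (?n + k, snd P)"
  have fst_Q: "fst Q = ?n + k" by (simp add: Q_def)
  obtain m where m: "primitive P Q m" and m_gen: "\<And>i. i < ?n \<Longrightarrow> m (fp_gen P i) = fp_gen Q i"
    using extend_presentation[OF P, of "?n + k"] by (auto simp: Q_def)
  have Q: "presentation Q" using m by (simp add: primitive_def)
  have gen: "points_map P m e (fp_gen P i) = e (fp_gen Q i)" if "i < ?n" for e :: "fp_elem \<Rightarrow> 'a" and i
    using fp_gen_carrier[OF P that] m_gen[OF that] by (simp add: points_map_def compose_eq)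
  let ?M = "MPoly A {..<fst Q}"
  interpret M: cring ?M by (rule A.MPoly_cring)
  \<comment> \<open>Parameters turn into constant polynomials, and the 0 at meaningless indices
    matches the default values of \<open>penv\<close>.\<close>
  define \<sigma> where "\<sigma> = case_sum
    (case_sum (\<lambda>i. if i < ?n then Var A i else \<zero>\<^bsub>?M\<^esub>) (\<lambda>a. if a \<in> carrier A then monomial A a {#} else \<zero>\<^bsub>?M\<^esub>))
    (\<lambda>j. if j < k then Var A (?n + j) else \<zero>\<^bsub>?M\<^esub>)"
  have Var: "Var A i \<in> carrier ?M" if "i < ?n + k" for i
    unfolding Var_monomial using that by (intro A.monomial_carrier) (auto simp: Q_def)
  have \<sigma>: "\<sigma> v \<in> carrier ?M" for v
    using Var M.zero_closed unfolding \<sigma>_def by (auto split: sum.split simp del: MPoly_simps)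
  define S where "S = ev ?M \<sigma> ` set \<Theta>"
  define V where "V = {e \<in> points A Q. \<forall>p\<in>S. mpoly_eval A (\<lambda>i. e (fp_gen Q i)) p = \<zero>\<^bsub>A\<^esub>}"
  \<comment> \<open>The bound variable \<open>j\<close> is read off from coordinate
    \<open>?n + j\<close>, after the coordinates of \<open>P\<close>.\<close>
  define ys where "ys e j = (if j < k then e (fp_gen Q (?n + j)) else \<zero>\<^bsub>A\<^esub>)" for e and j :: nat
  have key: "mpoly_eval A (\<lambda>i. e (fp_gen Q i)) (ev ?M \<sigma> t) =
      ev A (case_sum (penv A P (points_map P m e)) (ys e)) t" if e: "e \<in> points A Q" for e t
  proof -
    have c: "(\<lambda>i. e (fp_gen Q i)) \<in> {..<fst Q} \<rightarrow> carrier A"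
      using point_gen_carrier[OF Q e] by auto
    interpret pe: poly_eval A A id "\<lambda>i. e (fp_gen Q i)" "{..<fst Q}"
      using A c by (intro poly_eval.intro poly_eval_axioms.intro id_ring_hom)
    have zero: "pe.eval \<zero>\<^bsub>?M\<^esub> = \<zero>\<^bsub>A\<^esub>"
      using ring_hom_zero[OF pe.eval_hom M.ring_axioms A.ring_axioms] .
    have "pe.eval (ev ?M \<sigma> t) = ev A (pe.eval \<circ> \<sigma>) t"
      using \<sigma> by (intro ev_hom M.ring_axioms A.ring_axioms pe.eval_hom)
    also have "pe.eval \<circ> \<sigma> = case_sum (penv A P (points_map P m e)) (ys e)"
    proof
      fix v
      show "(pe.eval \<circ> \<sigma>) v = case_sum (penv A P (points_map P m e)) (ys e) v"
        using zero by (auto simp: \<sigma>_def penv_def ys_def gen pe.eval_Var pe.eval_const fst_Q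
          simp del: MPoly_simps split: sum.split)
    qed
    finally show ?thesis by (simp only: pe.eval_def id_comp)
  qed
  have "affine_variety A Q V"
    unfolding affine_variety_def
  proof (intro exI conjI)
    show "finite S" by (simp add: S_def)
    show "S \<subseteq> carrier (MPoly A {..<fst Q})"
      unfolding S_def using M.ev_closed[OF \<sigma>] by auto
  qed (rule V_def)
  then have "pos_definable A P (points_map P m ` V)"
    by (intro pos_definable.image[OF m] pos_definable.variety Q)
  moreover have "points_map P m ` V = pp_set A P \<Theta>"
  proof (intro equalityI subsetI)
    fix c assume "c \<in> points_map P m ` V"
    then obtain e where e: "e \<in> points A Q" "e \<in> V" "c = points_map P m e"
      by (auto simp: V_def)
    have "sat A \<Theta> (penv A P c)"
    proof (rule satI)
      show "ys e j \<in> carrier A" for j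
        using point_gen_carrier[OF Q e(1)] by (simp add: ys_def Q_def)
      show "ev A (case_sum (penv A P c) (ys e)) t = \<zero>\<^bsub>A\<^esub>" if "t \<in> set \<Theta>" for t
        using e(2) that by (simp add: V_def S_def e(3) flip: key[OF e(1)])
    qed
    then show "c \<in> pp_set A P \<Theta>"
      using points_map_point[OF m e(1)] by (simp add: pp_set_def e(3))
  next
    fix c assume "c \<in> pp_set A P \<Theta>"
    then have c: "c \<in> points A P" and sat: "sat A \<Theta> (penv A P c)"
      by (auto simp: pp_set_def)
    obtain y where y: "\<And>j. y j \<in> carrier A" "\<And>t. t \<in> set \<Theta> \<Longrightarrow> ev A (case_sum (penv A P c) y) t = \<zero>\<^bsub>A\<^esub>"
      using sat by (rule satE) blast
    \<comment> \<open>The coordinates of the point followed by the witnesses.\<close>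
    define x where "x i = (if i < ?n then c (fp_gen P i) else y (i - ?n))" for i
    have "zeval A (\<lambda>i. c (fp_gen P i)) p = zeval A x p" if "p \<in> set (snd P)" for p
      using point_gen_carrier[OF P c] by (intro zeval_cong[OF A presentation_mem[OF P that]]) (auto simp: x_def)
    then have "x \<in> zeros A Q"
      using point_zeros[OF A P c] point_gen_carrier[OF P c] y(1) by (auto simp: zeros_def Q_def x_def)
    then obtain e where e: "e \<in> points A Q" "\<And>i. i < fst Q \<Longrightarrow> e (fp_gen Q i) = x i"
      using point_exists[OF A Q] by blast
    have ce: "c = points_map P m e"
    proof (rule point_unique[OF A P c points_map_point[OF m e(1)]])
      show "c (fp_gen P i) = points_map P m e (fp_gen P i)" if "i < ?n" for i
        using that e(2)[of i] by (simp add: gen x_def Q_def)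
    qed
    have ev: "ev A (case_sum (penv A P c) (ys e)) t = \<zero>\<^bsub>A\<^esub>" if t: "t \<in> set \<Theta>" for t
    proof -
      have "ev A (case_sum (penv A P c) (ys e)) t = ev A (case_sum (penv A P c) y) t"
      proof (rule ev_cong)
        fix v assume v: "v \<in> vars t"
        show "case_sum (penv A P c) (ys e) v = case_sum (penv A P c) y v"
        proof (cases v)
          case (Inr j)
          then have "j < k" using k t v by blast
          then show ?thesis
            using Inr e(2)[of "?n + j"] by (simp add: ys_def x_def Q_def)
        qed simp
      qed
      then show ?thesis using y(2)[OF t] by simp
    qed
    have "mpoly_eval A (\<lambda>i. e (fp_gen Q i)) (ev ?M \<sigma> t) = \<zero>\<^bsub>A\<^esub>" if "t \<in> set \<Theta>" for t
      unfolding key[OF e(1)] ce[symmetric] using that by (rule ev)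
    then have "e \<in> V"
      using e(1) unfolding V_def S_def by blast
    then show "c \<in> points_map P m ` V"
      using ce by blast
  qed
  ultimately show ?thesis by simp
qed

text \<open>The coefficients are named by the free variables \<open>Inr a\<close>, so each
  polynomial becomes a term and no bound variable is needed.\<close>

lemma variety_pp_set:
  assumes A: "cring A" and P: "presentation P" and V: "affine_variety A P V"
  shows "\<exists>\<Theta>. V = pp_set A P \<Theta>"
proof -
  interpret A: cring A by fact
  let ?M = "MPoly A {..<fst P}"
  interpret M: cring ?M by (rule A.MPoly_cring)
  obtain S where S: "finite S" "S \<subseteq> carrier ?M"
    and V: "V = {c \<in> points A P. \<forall>p\<in>S. mpoly_eval A (\<lambda>i. c (fp_gen P i)) p = \<zero>\<^bsub>A\<^esub>}"
    using V unfolding affine_variety_def by blast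
  define \<rho> where "\<rho> = case_sum (Var A) (\<lambda>a. monomial A a {#})"
  let ?W = "Inl ` {..<fst P} \<union> Inr ` carrier A :: (nat + _) set"
  have \<rho>: "\<rho> v \<in> carrier ?M" if "v \<in> ?W" for v
    using that unfolding \<rho>_def Var_monomial by auto
  have "\<forall>p\<in>S. \<exists>t. vars t \<subseteq> ?W \<and> ev ?M \<rho> t = p"
  proof
    fix p assume "p \<in> S"
    with S(2) have "p \<in> carrier ?M" by blast
    then show "\<exists>t. vars t \<subseteq> ?W \<and> ev ?M \<rho> t = p"
    proof (rule MPoly_term_generated[OF A])
      show "\<exists>t. vars t \<subseteq> ?W \<and> ev ?M \<rho> t = monomial A a {#}" if "a \<in> carrier A" for a
        using that by (intro exI[of _ "TVar (Inr a)"]) (simp add: \<rho>_def)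
      show "\<exists>t. vars t \<subseteq> ?W \<and> ev ?M \<rho> t = Var A i" if "i \<in> {..<fst P}" for i
        using that by (intro exI[of _ "TVar (Inl i)"]) (simp add: \<rho>_def)
    qed
  qed
  from bchoice[OF this] obtain \<tau> where \<tau>: "\<And>p. p \<in> S \<Longrightarrow> vars (\<tau> p) \<subseteq> ?W" "\<And>p. p \<in> S \<Longrightarrow> ev ?M \<rho> (\<tau> p) = p"
    by blast
  obtain ps where ps: "set ps = S" using finite_list[OF S(1)] by blast
  let ?\<Theta> = "map (\<lambda>p. map_rterm Inl (\<tau> p)) ps :: ((nat + _) + nat) rterm list"
  have ev: "mpoly_eval A (\<lambda>i. c (fp_gen P i)) p = ev A (penv A P c) (\<tau> p)"
    if c: "c \<in> points A P" and p: "p \<in> S" for c p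
  proof -
    have x: "(\<lambda>i. c (fp_gen P i)) \<in> {..<fst P} \<rightarrow> carrier A"
      using point_gen_carrier[OF P c] by auto
    interpret pe: poly_eval A A id "\<lambda>i. c (fp_gen P i)" "{..<fst P}"
      using A x by (intro poly_eval.intro poly_eval_axioms.intro id_ring_hom)
    have "pe.eval (ev ?M \<rho> (\<tau> p)) = ev A (pe.eval \<circ> \<rho>) (\<tau> p)"
      using \<rho> \<tau>(1)[OF p] by (intro ev_hom M.ring_axioms A.ring_axioms pe.eval_hom) blast
    also have "\<dots> = ev A (penv A P c) (\<tau> p)"
    proof (rule ev_cong)
      fix v assume "v \<in> vars (\<tau> p)"
      then have "v \<in> ?W" using \<tau>(1)[OF p] by blast
      then show "(pe.eval \<circ> \<rho>) v = penv A P c v"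
        by (auto simp: \<rho>_def penv_def pe.eval_Var pe.eval_const)
    qed
    finally show ?thesis by (simp add: \<tau>(2)[OF p] pe.eval_def)
  qed
  have Inl: "case_sum x y \<circ> Inl = x" for x :: "nat + 'a \<Rightarrow> 'a" and y :: "nat \<Rightarrow> 'a" by auto
  have "sat A ?\<Theta> x \<longleftrightarrow> (\<forall>p\<in>S. ev A x (\<tau> p) = \<zero>\<^bsub>A\<^esub>)" for x
    using A.zero_closed by (auto simp: sat_def ev_map Inl ps)
  then have "V = pp_set A P ?\<Theta>"
    using ev by (auto simp: V pp_set_def)
  then show ?thesis by blast
qed

section \<open>Conjunctions and images of primitive positive sets\<close>

definition pp_conj :: "('v + nat) rterm list \<Rightarrow> ('v + nat) rterm list \<Rightarrow> ('v + nat) rterm list"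
  where "pp_conj \<Theta> \<Theta>' = map (map_rterm (map_sum id (\<lambda>j. 2 * j))) \<Theta> @
    map (map_rterm (map_sum id (\<lambda>j. Suc (2 * j)))) \<Theta>'"

definition interleave :: "(nat \<Rightarrow> 'a) \<Rightarrow> (nat \<Rightarrow> 'a) \<Rightarrow> nat \<Rightarrow> 'a"
  where "interleave y z j = (if even j then y (j div 2) else z (j div 2))"

lemma interleave_simps [simp]:
  "interleave y z (2 * j) = y j" "interleave y z (Suc (2 * j)) = z j"
  by (auto simp: interleave_def)

text \<open>Even and odd bound variables keep the witnesses of the two formulas apart.\<close>

lemma sat_pp_conj: "sat R (pp_conj \<Theta> \<Theta>') x \<longleftrightarrow> sat R \<Theta> x \<and> sat R \<Theta>' x"
proof -
  have eq: "case_sum x y \<circ> map_sum id g = case_sum x (y \<circ> g)" for y and g :: "nat \<Rightarrow> nat"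
    by (auto split: sum.split)
  show ?thesis
  proof (intro iffI conjI; (elim conjE)?)
    assume "sat R (pp_conj \<Theta> \<Theta>') x"
    then obtain y where y: "\<And>j. y j \<in> carrier R"
      "\<And>t. t \<in> set (pp_conj \<Theta> \<Theta>') \<Longrightarrow> ev R (case_sum x y) t = \<zero>\<^bsub>R\<^esub>"
      by (rule satE) blast
    show "sat R \<Theta> x"
    proof (rule satI)
      show "(y \<circ> (\<lambda>j. 2 * j)) j \<in> carrier R" for j
        using y(1) by simp
      fix t assume "t \<in> set \<Theta>"
      then have "map_rterm (map_sum id (\<lambda>j. 2 * j)) t \<in> set (pp_conj \<Theta> \<Theta>')"
        by (simp add: pp_conj_def)
      from y(2)[OF this] show "ev R (case_sum x (y \<circ> (\<lambda>j. 2 * j))) t = \<zero>\<^bsub>R\<^esub>"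
        by (simp only: ev_map eq)
    qed
    show "sat R \<Theta>' x"
    proof (rule satI)
      show "(y \<circ> (\<lambda>j. Suc (2 * j))) j \<in> carrier R" for j
        using y(1) by simp
      fix t assume "t \<in> set \<Theta>'"
      then have "map_rterm (map_sum id (\<lambda>j. Suc (2 * j))) t \<in> set (pp_conj \<Theta> \<Theta>')"
        by (simp add: pp_conj_def)
      from y(2)[OF this] show "ev R (case_sum x (y \<circ> (\<lambda>j. Suc (2 * j)))) t = \<zero>\<^bsub>R\<^esub>"
        by (simp only: ev_map eq)
    qed
  next
    assume "sat R \<Theta> x" "sat R \<Theta>' x"
    then obtain y z where y: "\<And>j. y j \<in> carrier R" "\<And>t. t \<in> set \<Theta> \<Longrightarrow> ev R (case_sum x y) t = \<zero>\<^bsub>R\<^esub>"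
      and z: "\<And>j. z j \<in> carrier R" "\<And>t. t \<in> set \<Theta>' \<Longrightarrow> ev R (case_sum x z) t = \<zero>\<^bsub>R\<^esub>"
      by (meson satE)
    have "interleave y z \<circ> (\<lambda>j. 2 * j) = y" "interleave y z \<circ> (\<lambda>j. Suc (2 * j)) = z"
      by auto
    then show "sat R (pp_conj \<Theta> \<Theta>') x"
      using y z by (intro satI[where y = "interleave y z"]) (auto simp: interleave_def pp_conj_def ev_map eq)
  qed
qed

text \<open>The even bound variables stand for the coordinates of a point of \<open>Q\<close>, the odd ones for the
  bound variables of \<open>\<Theta>\<close>.\<close>

definition pp_image ::
    "('a, 'r) ring_scheme \<Rightarrow> presentation \<Rightarrow> presentation \<Rightarrow> (fp_elem \<Rightarrow> fp_elem) \<Rightarrow>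
      ((nat + 'a) + nat) rterm list \<Rightarrow> ((nat + 'a) + nat) rterm list"
  where "pp_image A P Q m \<Theta> =
    map (map_rterm (map_sum Inl (\<lambda>j. 2 * j))) (morph_terms P Q m) @
    map (map_rterm (case_sum
      (case_sum (\<lambda>i. if i < fst Q then Inr (2 * i) else Inl (Inr \<zero>\<^bsub>A\<^esub>)) (\<lambda>a. Inl (Inr a)))
      (\<lambda>j. Inr (Suc (2 * j))))) \<Theta>"

text \<open>A preimage point and the witnesses for \<open>\<Theta>\<close> at this point are
  quantified together in one formula.\<close>

lemma points_map_pp_set:
  assumes A: "cring A" and m: "primitive P Q m"
  shows "points_map P m ` pp_set A Q \<Theta> = pp_set A P (pp_image A P Q m \<Theta>)"
proof -
  interpret A: cring A by fact
  have P: "presentation P" and Q: "presentation Q"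
    using m by (auto simp: primitive_def)
  define xs where "xs c i = (if i < fst P then c (fp_gen P i) else \<zero>\<^bsub>A\<^esub>)" for c i
  \<comment> \<open>The environment \<open>penv A Q e\<close> rebuilt from the coordinates
    \<open>y\<close> of a point \<open>e\<close>.\<close>
  define xq where "xq y = case_sum (\<lambda>i. if i < fst Q then y i else \<zero>\<^bsub>A\<^esub>) (\<lambda>a. if a \<in> carrier A then a else \<zero>\<^bsub>A\<^esub>)" for y
  have sat: "sat A (pp_image A P Q m \<Theta>) (penv A P c) \<longleftrightarrow>
      (\<exists>y z. (\<forall>j. y j \<in> carrier A) \<and> (\<forall>j. z j \<in> carrier A) \<and> y \<in> zeros A Q \<and>
        (\<forall>i<fst P. c (fp_gen P i) = zeval A y (gen_poly P Q m i)) \<and>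
        (\<forall>t\<in>set \<Theta>. ev A (case_sum (xq y) z) t = \<zero>\<^bsub>A\<^esub>))" (is "_ \<longleftrightarrow> ?rhs") if c: "c \<in> points A P" for c
  proof -
    have xs: "xs c i \<in> carrier A" for i
      using point_gen_carrier[OF P c] by (simp add: xs_def)
    have e1: "case_sum (penv A P c) w \<circ> map_sum Inl (\<lambda>j. 2 * j) = case_sum (xs c) (w \<circ> (\<lambda>j. 2 * j))" for w
      by (auto simp: fun_eq_iff penv_def xs_def split: sum.split)
    \<comment> \<open>Free variables from \<open>fst Q\<close> on were replaced by the constant 0,
      in agreement with their value in \<open>penv\<close>.\<close>
    have e2: "case_sum (penv A P c) w \<circ> case_sum
        (case_sum (\<lambda>i. if i < fst Q then Inr (2 * i) else Inl (Inr \<zero>\<^bsub>A\<^esub>)) (\<lambda>a. Inl (Inr a)))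
        (\<lambda>j. Inr (Suc (2 * j))) = case_sum (xq (w \<circ> (\<lambda>j. 2 * j))) (w \<circ> (\<lambda>j. Suc (2 * j)))" for w
      by (auto simp: fun_eq_iff penv_def xq_def split: sum.split)
    have vanish: "(\<forall>t\<in>set (pp_image A P Q m \<Theta>). ev A (case_sum (penv A P c) w) t = \<zero>\<^bsub>A\<^esub>) \<longleftrightarrow>
        w \<circ> (\<lambda>j. 2 * j) \<in> zeros A Q \<and>
        (\<forall>i<fst P. c (fp_gen P i) = zeval A (w \<circ> (\<lambda>j. 2 * j)) (gen_poly P Q m i)) \<and>
        (\<forall>t\<in>set \<Theta>. ev A (case_sum (xq (w \<circ> (\<lambda>j. 2 * j))) (w \<circ> (\<lambda>j. Suc (2 * j)))) t = \<zero>\<^bsub>A\<^esub>)"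
      if w: "\<And>j. w j \<in> carrier A" for w
    proof -
      have "(\<forall>t\<in>set (morph_terms P Q m). ev A (case_sum (xs c) (w \<circ> (\<lambda>j. 2 * j))) t = \<zero>\<^bsub>A\<^esub>) \<longleftrightarrow>
          w \<circ> (\<lambda>j. 2 * j) \<in> zeros A Q \<and>
          (\<forall>i<fst P. xs c i = zeval A (w \<circ> (\<lambda>j. 2 * j)) (gen_poly P Q m i))"
        using w by (intro morph_terms_vanish_iff[OF A m xs]) simp
      then show ?thesis
        unfolding pp_image_def set_append ball_Un set_map ball_simps ev_map e1 e2
        by (simp add: xs_def)
    qed
    show ?thesis
    proof
      assume "sat A (pp_image A P Q m \<Theta>) (penv A P c)"
      then obtain w where w: "\<And>j. w j \<in> carrier A"
        "\<And>t. t \<in> set (pp_image A P Q m \<Theta>) \<Longrightarrow> ev A (case_sum (penv A P c) w) t = \<zero>\<^bsub>A\<^esub>"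
        by (rule satE) blast
      then show ?rhs
        using vanish[of w] by (intro exI[of _ "w \<circ> (\<lambda>j. 2 * j)"] exI[of _ "w \<circ> (\<lambda>j. Suc (2 * j))"]) simp
    next
      assume ?rhs
      then obtain y z where yz: "\<forall>j. y j \<in> carrier A" "\<forall>j. z j \<in> carrier A" "y \<in> zeros A Q"
        "\<forall>i<fst P. c (fp_gen P i) = zeval A y (gen_poly P Q m i)"
        "\<forall>t\<in>set \<Theta>. ev A (case_sum (xq y) z) t = \<zero>\<^bsub>A\<^esub>"
        by blast
      have w: "interleave y z j \<in> carrier A" for j
        using yz(1,2) by (simp add: interleave_def)
      have "interleave y z \<circ> (\<lambda>j. 2 * j) = y" "interleave y z \<circ> (\<lambda>j. Suc (2 * j)) = z"
        by auto
      then have "\<forall>t\<in>set (pp_image A P Q m \<Theta>). ev A (case_sum (penv A P c) (interleave y z)) t = \<zero>\<^bsub>A\<^esub>"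
        using yz(3-5) by (simp add: vanish[OF w])
      then show "sat A (pp_image A P Q m \<Theta>) (penv A P c)"
        using w by (intro satI[where y = "interleave y z"]) auto
    qed
  qed
  show ?thesis
  proof (intro equalityI subsetI)
    fix c assume "c \<in> points_map P m ` pp_set A Q \<Theta>"
    then obtain e where e: "e \<in> points A Q" "sat A \<Theta> (penv A Q e)" "c = points_map P m e"
      by (auto simp: pp_set_def)
    then have c: "c \<in> points A P" using points_map_point[OF m] by blast
    obtain z where z: "\<forall>j. z j \<in> carrier A" "\<forall>t\<in>set \<Theta>. ev A (case_sum (penv A Q e) z) t = \<zero>\<^bsub>A\<^esub>"
      using e(2) unfolding sat_def by blast
    \<comment> \<open>Coordinates of the preimage, cut off by 0 because witnesses must lie in the
      carrier at every index.\<close>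
    define y where "y i = (if i < fst Q then e (fp_gen Q i) else \<zero>\<^bsub>A\<^esub>)" for i
    have y: "\<forall>j. y j \<in> carrier A"
      using point_gen_carrier[OF Q e(1)] by (simp add: y_def)
    have cong: "zeval A (\<lambda>i. e (fp_gen Q i)) p = zeval A y p" if "p \<in> carrier (MPoly \<Z> {..<fst Q})" for p
      using point_gen_carrier[OF Q e(1)] by (intro zeval_cong[OF A that]) (auto simp: y_def)
    have "y \<in> zeros A Q"
      using point_zeros[OF A Q e(1)] y cong presentation_mem[OF Q] by (simp add: zeros_def)
    moreover have "\<forall>i<fst P. c (fp_gen P i) = zeval A y (gen_poly P Q m i)"
      using points_map_gen[OF A m e(1)] cong gen_poly(1)[OF m] by (simp add: e(3))
    moreover have "xq y = penv A Q e"
      by (auto simp: fun_eq_iff xq_def penv_def y_def split: sum.split)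
    ultimately have "sat A (pp_image A P Q m \<Theta>) (penv A P c)"
      unfolding sat[OF c] using y z by metis
    then show "c \<in> pp_set A P (pp_image A P Q m \<Theta>)"
      using c by (simp add: pp_set_def)
  next
    fix c assume "c \<in> pp_set A P (pp_image A P Q m \<Theta>)"
    then have c: "c \<in> points A P" and "sat A (pp_image A P Q m \<Theta>) (penv A P c)"
      by (auto simp: pp_set_def)
    then obtain y z where yz: "\<forall>j. y j \<in> carrier A" "\<forall>j. z j \<in> carrier A" "y \<in> zeros A Q"
        "\<forall>i<fst P. c (fp_gen P i) = zeval A y (gen_poly P Q m i)"
        "\<forall>t\<in>set \<Theta>. ev A (case_sum (xq y) z) t = \<zero>\<^bsub>A\<^esub>"
      unfolding sat[OF c] by blast
    obtain e where e: "e \<in> points A Q" "\<And>j. j < fst Q \<Longrightarrow> e (fp_gen Q j) = y j"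
      using point_exists[OF A Q yz(3)] by blast
    have "c = points_map P m e"
    proof (rule point_unique[OF A P c points_map_point[OF m e(1)]])
      fix i assume i: "i < fst P"
      have "zeval A (\<lambda>j. e (fp_gen Q j)) (gen_poly P Q m i) = zeval A y (gen_poly P Q m i)"
        using e(2) point_gen_carrier[OF Q e(1)] by (intro zeval_cong[OF A gen_poly(1)[OF m i]]) auto
      then show "c (fp_gen P i) = points_map P m e (fp_gen P i)"
        using yz(4) i by (simp add: points_map_gen[OF A m e(1) i])
    qed
    moreover have "penv A Q e = xq y"
      using e(2) by (auto simp: fun_eq_iff xq_def penv_def split: sum.split)
    then have "e \<in> pp_set A Q \<Theta>"
      using e(1) yz(2,5) unfolding pp_set_def sat_def by auto
    ultimately show "c \<in> points_map P m ` pp_set A Q \<Theta>" by blast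
  qed
qed

section \<open>Normal form and complements\<close>

lemma pos_definable_presentation: "pos_definable A P V \<Longrightarrow> presentation P"
  by (induction rule: pos_definable.induct) (auto simp: primitive_def)

text \<open>A disjunctive normal form: intersections distribute over the unions and images commute
  with them, so only single formulas have to be conjoined or projected.\<close>

lemma pos_definable_pp_sets:
  assumes A: "cring A" and "pos_definable A P V"
  shows "\<exists>G. finite G \<and> V = (\<Union>\<Theta>\<in>G. pp_set A P \<Theta>)"
  using assms(2)
proof (induction rule: pos_definable.induct)
  case (empty P)
  show ?case by (intro exI[of _ "{}"]) simp
next
  case (top P)
  interpret A: cring A by fact
  have "sat A [] x" for x :: "nat + 'a \<Rightarrow> 'a"
    by (rule satI[of "\<lambda>_. \<zero>\<^bsub>A\<^esub>"]) auto
  then show ?case by (intro exI[of _ "{[]}"]) (simp add: pp_set_def)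
next
  case (variety P V)
  then obtain \<Theta> where "V = pp_set A P \<Theta>"
    using variety_pp_set[OF A] by blast
  then show ?case by (intro exI[of _ "{\<Theta>}"]) simp
next
  case (union P V W)
  then obtain G H where "finite G" "V = (\<Union>\<Theta>\<in>G. pp_set A P \<Theta>)" "finite H" "W = (\<Union>\<Theta>\<in>H. pp_set A P \<Theta>)"
    by blast
  then show ?case by (intro exI[of _ "G \<union> H"]) auto
next
  case (inter P V W)
  then obtain G H where "finite G" "V = (\<Union>\<Theta>\<in>G. pp_set A P \<Theta>)" "finite H" "W = (\<Union>\<Theta>\<in>H. pp_set A P \<Theta>)"
    by blast
  moreover have "pp_set A P (pp_conj \<Theta> \<Theta>') = pp_set A P \<Theta> \<inter> pp_set A P \<Theta>'" for \<Theta> \<Theta>'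
    by (auto simp: pp_set_def sat_pp_conj)
  ultimately show ?case
    by (intro exI[of _ "(\<lambda>(\<Theta>, \<Theta>'). pp_conj \<Theta> \<Theta>') ` (G \<times> H)"]) (auto; blast)
next
  case (image P Q m V)
  then obtain G where "finite G" "V = (\<Union>\<Theta>\<in>G. pp_set A Q \<Theta>)"
    by blast
  then show ?case
    using points_map_pp_set[OF A image(1)]
    by (intro exI[of _ "pp_image A P Q m ` G"]) (simp add: image_UN)
qed

lemma pos_definable_UN:
  assumes "presentation P" "finite G" "\<And>\<Theta>. \<Theta> \<in> G \<Longrightarrow> pos_definable A P (F \<Theta>)"
  shows "pos_definable A P (\<Union>\<Theta>\<in>G. F \<Theta>)"
  using assms(2,3) by (induction G) (auto intro: pos_definable.empty[OF assms(1)] pos_definable.union)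

text \<open>In normal form the complement is a finite intersection of complements of single
  formulas, each a finite union of such sets by \<open>sat_complement\<close>.\<close>

lemma pos_definable_compl:
  fixes A :: "('a, 'r) ring_scheme"
  assumes u: "infinite (UNIV :: 'u set)" and gc: "geometrically_closed TYPE('u) A"
    and V: "pos_definable A P V"
  shows "pos_definable A P (points A P - V)"
proof -
  have A: "cring A" using gc by (simp add: geometrically_closed_def)
  have P: "presentation P" using V by (rule pos_definable_presentation)
  have pp: "pos_definable A P (points A P - pp_set A P \<Theta>)" for \<Theta>
  proof -
    obtain \<Psi> where \<Psi>: "finite \<Psi>" "\<forall>x. (\<forall>v. x v \<in> carrier A) \<longrightarrow> (sat A \<Theta> x \<longleftrightarrow> \<not> (\<exists>\<psi>\<in>\<Psi>. sat A \<psi> x))"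
      using sat_complement[OF u gc, of \<Theta>] by blast
    have "sat A \<Theta> (penv A P c) \<longleftrightarrow> \<not> (\<exists>\<psi>\<in>\<Psi>. sat A \<psi> (penv A P c))" if "c \<in> points A P" for c
      using \<Psi>(2) penv_carrier[OF A P that] by blast
    then have eq: "points A P - pp_set A P \<Theta> = (\<Union>\<psi>\<in>\<Psi>. pp_set A P \<psi>)"
      unfolding pp_set_def by blast
    show ?thesis
      unfolding eq by (intro pos_definable_UN P \<Psi>(1) pos_definable_pp_set A)
  qed
  obtain G where G: "finite G" "V = (\<Union>\<Theta>\<in>G. pp_set A P \<Theta>)"
    using pos_definable_pp_sets[OF A V] by blast
  have "pos_definable A P (points A P - (\<Union>\<Theta>\<in>G. pp_set A P \<Theta>))"
    using G(1)
  proof (induction G)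
    case empty
    show ?case using pos_definable.top[OF P] by simp
  next
    case (insert \<Theta> G)
    have "points A P - (\<Union>\<Theta>\<in>insert \<Theta> G. pp_set A P \<Theta>) =
        (points A P - pp_set A P \<Theta>) \<inter> (points A P - (\<Union>\<Theta>\<in>G. pp_set A P \<Theta>))"
      by blast
    then show ?case
      using pos_definable.inter[OF pp insert.IH] by simp
  qed
  then show ?thesis by (simp add: G(2))
qed

theorem corollary4p7:
  fixes A :: "('a, 'r) ring_scheme"
  assumes "infinite (UNIV :: 'u set)"
    and "cring A"
    and "geometrically_closed TYPE('u) A"
  shows "\<forall>P. presentation P \<longrightarrow> Def_sets A P = Def_pos_sets A P"
proof -
  \<comment> \<open>Positively definable sets obey every rule generating the definable ones;
    complementation is the only one they lack by definition.\<close>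
  have "pos_definable A P V" if "definable A P V" for P V
    using that
    by (induction rule: definable.induct)
      (auto intro: pos_definable.intros pos_definable_compl[OF assms(1,3)])
  moreover have "definable A P V" if "pos_definable A P V" for P V
    using that by (induction rule: pos_definable.induct) (auto intro: definable.intros)
  ultimately show ?thesis
    unfolding Def_sets_def Def_pos_sets_def by blast
qed

end
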